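(* Let $P\subset\mathbb{R}^n$ be a Delzant polytope with vertices in $\mathbb{Z}^n$ and let $\varphi\in C^\infty_{g_P}(P)$. For any $\psi$ strictly convex in a neighborhood of $P$ and any $m\in P\cap\mathbb{Z}^n$, consider the family of $L^1$-normalized $J_s$-holomorphic sections $$\mathbb{R}^+\ni s\mapsto \xi^m_s:=\frac{\sigma^m_s}{\|\sigma^m_s\|_1}\in C^\infty(L_\omega)\overset{\iota}{\subset}(C^\infty_c(L_\omega^{-1}))',$$ where $J_s$ and $\sigma_s^m$ are determined by $g_s=g_P+\varphi+s\psi$. Then, as $s\to\infty$, $\iota(\xi^m_s)$ converges to $\delta^m$ in $(C_c^\infty(L_\omega^{-1}))'$.
   Context: **Toric manifold.** $P=\{x\in\mathbb{R}^n:\ell_r(x)={}^t\nu_r x-\lambda_r\ge 0,\ r=1,\dots,d\}$ is a (compact) Delzant polytope with vertices in $\mathbb{Z}^n$: $\lambda_r\in\mathbb{Z}$, $\nu_r\in\mathbb{Z}^n$ is the primitive inward-pointing normal of the $r$-th facet, and at each vertex exactly $n$ facets meet and their normals form a $\mathbb{Z}$-basis of $\mathbb{Z}^n$. $\breve P$ is the interior of $P$. $(X_P,\omega,\mathbb{T}^n,\mu_P)$ is the associated compact symplectic toric manifold, $\mathbb{T}^n=\mathbb{R}^n/2\pi\mathbb{Z}^n$, with moment map $\mu_P:X_P\to P$. On $\breve X_P=\mu_P^{-1}(\breve P)\cong\breve P\times\mathbb{T}^n$ one has coordinates $(x,\theta)$ with $\omega=\sum_i dx_i\wedge d\theta_i$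 and $\mu_P(x,\theta)=x$. **Vertex charts.** For a vertex $v$ of $P$, fix an ordering of the $n$ facets containing $v$; let $A$ be the matrix whose rows are their normals and $\lambda$ the vector of the corresponding $\lambda_r$, and put $l=\ell(x)=Ax-\lambda$ (so $\ell(v)=0$) and $\vartheta={}^tA^{-1}\theta$. Let $\breve P_v$ be the union of the relative interiors of all faces of $P$ containing $v$ (including $\{v\}$ and $\breve P$), and $V_v=\mu_P^{-1}(\breve P_v)$, an open set with smooth complex-valued coordinates $\sqrt{2l_j}\,e^{i\vartheta_j}$. The sets $V_v$ cover $X_P$. **Prequantum bundle.** $L_\omega\to X_P$ is the Hermitian line bundle with unitary trivializing sections $\mathbb{1}^{U(1)}_v$ over $V_v$, related on overlaps by $\mathbb{1}^{U(1)}_v=e^{i\,{}^t(v-\tilde v)\theta}\,\mathbb{1}^{U(1)}_{\tilde v}$, with connection $\nabla\mathbb{1}^{U(1)}_v=-i\,{}^t(x-v)d\theta\,\mathbb{1}^{U(1)}_v=-i\,{}^tl\,d\vartheta\,\mathbb{1}^{U(1)}_v$ of curvature $-i\omega$. The injection of smooth sections into distributional sections is $\iota:C^\infty(L_\omega)\to(C^\infty_c(L_\omega^{-1}))'$, $\iota s(\phi)=\int_{X_P}s\phi\,\frac{\omega^n}{n!}$. **Symplectic potentials.** $g_P(x)=\frac12\sum_{r=1}^d\ell_r(x)\log\ell_r(x)$. $C^\infty_{g_P}(P)$ is the set of $\varphi\in C^\infty(P)$ such that $\mathrm{Hess}_x(g_P+\varphi)$ is positive definite on $\breve P$ and $\det\mathrm{Hess}_x(g_P+\varphi)=[\alpha(x)\prod_{r=1}^d\ell_r(x)]^{-1}$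 with $\alpha$ smooth and strictly positive on $P$. "$\psi$ strictly convex in a neighborhood of $P$" means that $\psi$ is smooth with positive definite Hessian on an open neighborhood of $P$. The potential $g_s=g_P+\varphi+s\psi$ defines an $\omega$-compatible complex structure $J_s$ on $X_P$, for which $e^{y+i\theta}$, $y=\partial g_s/\partial x$, are holomorphic coordinates on $\breve X_P$. **Monomial sections.** For $m\in P\cap\mathbb{Z}^n$ let $h^s_m(x)={}^t(x-m)\frac{\partial g_s}{\partial x}-g_s(x)$. The $J_s$-holomorphic section $\sigma^m_s$ of $L_\omega$ is given on $V_v$ by $\sigma^m_s=e^{-h^s_m\circ\mu_P}e^{i\,{}^t\ell(m)\vartheta}\,\mathbb{1}^{U(1)}_v$ (it corresponds to the monomial $w^m$, $w=e^{y+i\theta}$, on the open orbit). $\|\cdot\|_1$ is the $L^1$-norm with respect to the Hermitian structure and the Liouville measure $\omega^n/n!$. **Delta sections.** For $m\in P\cap\mathbb{Z}^n$, $\delta^m(\tau)=\int_{\mu_P^{-1}(m)}e^{i\,{}^t\ell(m)\vartheta}\,\tau_v$ for $\tau\in C_c^\infty(L_\omega^{-1})$, where $v$ is a vertex with $\mu_P^{-1}(m)\subset V_v$, $\tau=\tau_v(\mathbb{1}^{U(1)}_v)^{-1}$ on $V_v$, and the integral is with respect to the $\mathbb{T}^n$-invariant measure of total mass $1$ on the orbit $\mu_P^{-1}(m)$. *)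

theory Defs
  imports "HOL-Analysis.Analysis"
begin

section \<open>Smooth functions\<close>

primrec iter_deriv ::
    "'a list \<Rightarrow> ('a::real_normed_vector \<Rightarrow> 'b::real_normed_vector) \<Rightarrow> 'a \<Rightarrow> 'b" where
  "iter_deriv [] f = f"
| "iter_deriv (h # hs) f = iter_deriv hs (\<lambda>x. frechet_derivative f (at x) h)"

text \<open>Meant for open \<open>S\<close> (derivatives are two-sided): all iterated directional derivatives exist
  and are differentiable, hence continuous, on \<open>S\<close>.\<close>

definition smooth_on ::
    "'a::real_normed_vector set \<Rightarrow> ('a \<Rightarrow> 'b::real_normed_vector) \<Rightarrow> bool" where
  "smooth_on S f \<longleftrightarrow> (\<forall>hs. \<forall>x\<in>S. iter_deriv hs f differentiable (at x))"

text \<open>Smoothness up to the boundary of a closed set; values of \<open>f\<close> off \<open>P\<close> are irrelevant.\<close>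

definition smooth_on_closed :: "(real^'n) set \<Rightarrow> (real^'n \<Rightarrow> real) \<Rightarrow> bool" where
  "smooth_on_closed P f \<longleftrightarrow>
     (\<exists>U F. open U \<and> P \<subseteq> U \<and> smooth_on U F \<and> (\<forall>x\<in>P. F x = f x))"

definition grad :: "(real^'n \<Rightarrow> real) \<Rightarrow> real^'n \<Rightarrow> real^'n" where
  "grad g x = (\<chi> i. frechet_derivative g (at x) (axis i 1))"

definition Hess :: "(real^'n \<Rightarrow> real) \<Rightarrow> real^'n \<Rightarrow> real^'n^'n" where
  "Hess g x = (\<chi> i j. frechet_derivative (\<lambda>y. grad g y $ i) (at x) (axis j 1))"

definition pos_def :: "real^'n^'n \<Rightarrow> bool" where
  "pos_def H \<longleftrightarrow> transpose H = H \<and> (\<forall>u. u \<noteq> 0 \<longrightarrow> 0 < u \<bullet> (H *v u))"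

definition strictly_convex_near :: "(real^'n) set \<Rightarrow> (real^'n \<Rightarrow> real) \<Rightarrow> bool" where
  "strictly_convex_near P \<psi> \<longleftrightarrow>
     (\<exists>U. open U \<and> P \<subseteq> U \<and> smooth_on U \<psi> \<and> (\<forall>x\<in>U. pos_def (Hess \<psi> x)))"


section \<open>Delzant polytopes\<close>

definition real_vec :: "int^'n \<Rightarrow> real^'n" where
  "real_vec k = (\<chi> i. real_of_int (k $ i))"

definition lattice :: "(real^'n) set" where
  "lattice = range real_vec"

text \<open>A facet is encoded by its pair \<open>r = (\<nu>\<^sub>r, \<lambda>\<^sub>r)\<close>, and
  \<open>ell r x\<close> is \<open>\<nu>\<^sub>r \<bullet> x - \<lambda>\<^sub>r\<close>.\<close>

definition ell :: "(int^'n) \<times> int \<Rightarrow> real^'n \<Rightarrow> real" where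
  "ell r x = real_vec (fst r) \<bullet> x - real_of_int (snd r)"

definition facet_data :: "(real^'n) set \<Rightarrow> ((int^'n) \<times> int) set" where
  "facet_data P = {r. Gcd (range (\<lambda>i. fst r $ i)) = 1 \<and>
     P \<subseteq> {x. 0 \<le> ell r x} \<and> {x \<in> P. ell r x = 0} facet_of P}"

definition vertices :: "(real^'n) set \<Rightarrow> (real^'n) set" where
  "vertices P = {v. v extreme_point_of P}"

definition active :: "(real^'n) set \<Rightarrow> real^'n \<Rightarrow> ((int^'n) \<times> int) set" where
  "active P x = {r \<in> facet_data P. ell r x = 0}"

text \<open>The last clause says that the normals of the facets through a vertex form a basis of the
  lattice of integer vectors.\<close>

definition delzant :: "(real^'n) set \<Rightarrow> bool" where
  "delzant P \<longleftrightarrow>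
     polytope P \<and> interior P \<noteq> {} \<and>
     finite (facet_data P) \<and> P = {x. \<forall>r\<in>facet_data P. 0 \<le> ell r x} \<and>
     (\<forall>v\<in>vertices P. v \<in> lattice \<and> card (active P v) = CARD('n) \<and>
        (\<forall>w::int^'n. \<exists>!c. (\<forall>r. r \<notin> active P v \<longrightarrow> c r = 0) \<and>
           w = (\<Sum>r\<in>active P v. c r *s fst r)))"


section \<open>The toric manifold\<close>

text \<open>\<open>toric_mfd P\<close> is the quotient of \<open>P \<times> T\<close>, \<open>T\<close> the torus of angles modulo \<open>2\<pi>\<close>, that
  collapses over \<open>x\<close> the subtorus generated by the normals of the facets through \<open>x\<close>.
  \<open>pt P x \<theta>\<close> is the point with moment map value \<open>x\<close> and angles \<open>\<theta>\<close>.\<close>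

type_synonym 'n point = "((real^'n) \<times> (real^'n)) set"

definition toric_rel :: "(real^'n) set \<Rightarrow> (((real^'n) \<times> (real^'n)) \<times> ((real^'n) \<times> (real^'n))) set" where
  "toric_rel P = {((x, \<theta>), (x', \<theta>')). x \<in> P \<and> x' = x \<and>
     (\<exists>k. \<theta>' - \<theta> - (2 * pi) *\<^sub>R real_vec k \<in> span ((real_vec \<circ> fst) ` active P x))}"

definition toric_mfd :: "(real^'n) set \<Rightarrow> 'n point set" where
  "toric_mfd P = (P \<times> UNIV) // toric_rel P"

definition pt :: "(real^'n) set \<Rightarrow> real^'n \<Rightarrow> real^'n \<Rightarrow> 'n point" where
  "pt P x \<theta> = toric_rel P `` {(x, \<theta>)}"

definition moment :: "'n point \<Rightarrow> real^'n" where
  "moment p = fst (SOME q. q \<in> p)"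

text \<open>Angles are determined only up to the equivalence; \<open>angles\<close> picks a representative.\<close>

definition angles :: "'n point \<Rightarrow> real^'n" where
  "angles p = snd (SOME q. q \<in> p)"

definition facet_order :: "(real^'n) set \<Rightarrow> real^'n \<Rightarrow> 'n \<Rightarrow> (int^'n) \<times> int" where
  "facet_order P v = (SOME e. bij_betw e UNIV (active P v))"

definition normal_matrix :: "(real^'n) set \<Rightarrow> real^'n \<Rightarrow> real^'n^'n" where
  "normal_matrix P v = (\<chi> j. real_vec (fst (facet_order P v j)))"

definition offset_vec :: "(real^'n) set \<Rightarrow> real^'n \<Rightarrow> real^'n" where
  "offset_vec P v = (\<chi> j. real_of_int (snd (facet_order P v j)))"

definition ell_at :: "(real^'n) set \<Rightarrow> real^'n \<Rightarrow> real^'n \<Rightarrow> real^'n" where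
  "ell_at P v x = normal_matrix P v *v x - offset_vec P v"

definition vartheta :: "(real^'n) set \<Rightarrow> real^'n \<Rightarrow> real^'n \<Rightarrow> real^'n" where
  "vartheta P v \<theta> = transpose (matrix_inv (normal_matrix P v)) *v \<theta>"

definition vertex_star :: "(real^'n) set \<Rightarrow> real^'n \<Rightarrow> (real^'n) set" where
  "vertex_star P v = \<Union> (rel_interior ` {F. F face_of P \<and> v \<in> F})"

definition chart_dom :: "(real^'n) set \<Rightarrow> real^'n \<Rightarrow> 'n point set" where
  "chart_dom P v = {p \<in> toric_mfd P. moment p \<in> vertex_star P v}"

definition chart :: "(real^'n) set \<Rightarrow> real^'n \<Rightarrow> 'n point \<Rightarrow> complex^'n" where
  "chart P v p = (\<chi> j. complex_of_real (sqrt (2 * ell_at P v (moment p) $ j)) *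
                       cis (vartheta P v (angles p) $ j))"

definition in_chart ::
    "(real^'n) set \<Rightarrow> real^'n \<Rightarrow> ('n point \<Rightarrow> complex) \<Rightarrow> complex^'n \<Rightarrow> complex" where
  "in_chart P v f = f \<circ> inv_into (chart_dom P v) (chart P v)"

text \<open>A fundamental domain of the torus, up to a null set.\<close>

definition torus_cell :: "(real^'n) set" where
  "torus_cell = cbox 0 (\<chi> i. 2 * pi)"

text \<open>Integration against the Liouville measure: the symplectic form is
  \<open>\<Sum>\<^sub>i dx\<^sub>i \<and> d\<theta>\<^sub>i\<close> on the open orbit, whose complement is a null set.\<close>

definition liouville_integral ::
    "(real^'n) set \<Rightarrow> ('n point \<Rightarrow> 'b::{banach,second_countable_topology}) \<Rightarrow> 'b" where
  "liouville_integral P f =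
     set_lebesgue_integral lborel (interior P \<times> torus_cell) (\<lambda>(x, \<theta>). f (pt P x \<theta>))"

definition orbit :: "(real^'n) set \<Rightarrow> real^'n \<Rightarrow> 'n point set" where
  "orbit P x = {p \<in> toric_mfd P. moment p = x}"

text \<open>Integration over an orbit against the torus-invariant measure of total mass 1.\<close>

definition orbit_integral ::
    "(real^'n) set \<Rightarrow> real^'n \<Rightarrow> ('n point \<Rightarrow> complex) \<Rightarrow> complex" where
  "orbit_integral P x f = integral\<^sup>L (uniform_measure lborel torus_cell) (\<lambda>\<theta>. f (pt P x \<theta>))"


section \<open>The prequantum bundle\<close>

text \<open>A section \<open>s\<close> of the \<open>k\<close>-th power of the prequantum bundle is the family of its
  coefficients \<open>s v\<close> over \<open>chart_dom P v\<close> in the unitary frames \<open>1\<^sub>v\<close>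
  (their \<open>k\<close>-th powers), extended by \<open>0\<close>; the frames satisfy
  \<open>1\<^sub>v = exp (i k (v - w) \<bullet> \<theta>) 1\<^sub>w\<close>.\<close>

type_synonym 'n section_family = "real^'n \<Rightarrow> 'n point \<Rightarrow> complex"

definition smooth_sections :: "(real^'n) set \<Rightarrow> int \<Rightarrow> 'n section_family set" where
  "smooth_sections P k = {s.
     (\<forall>v p. \<not> (v \<in> vertices P \<and> p \<in> chart_dom P v) \<longrightarrow> s v p = 0) \<and>
     (\<forall>v\<in>vertices P. \<forall>w\<in>vertices P. \<forall>p \<in> chart_dom P v \<inter> chart_dom P w.
        s w p = cis (real_of_int k * ((v - w) \<bullet> angles p)) * s v p) \<and>
     (\<forall>v\<in>vertices P. smooth_on (chart P v ` chart_dom P v) (in_chart P v (s v)))}"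

definition vertex_at :: "(real^'n) set \<Rightarrow> 'n point \<Rightarrow> real^'n" where
  "vertex_at P p = (SOME v. v \<in> vertices P \<and> p \<in> chart_dom P v)"

definition L1_norm :: "(real^'n) set \<Rightarrow> 'n section_family \<Rightarrow> real" where
  "L1_norm P s = liouville_integral P (\<lambda>p. cmod (s (vertex_at P p) p))"

text \<open>Since \<open>toric_mfd P\<close> is compact, compact support of test sections is automatic.\<close>

definition test_sections :: "(real^'n) set \<Rightarrow> 'n section_family set" where
  "test_sections P = smooth_sections P (- 1)"

text \<open>Continuous linear functionals for the usual Frechet topology on smooth sections, whose
  seminorms are the suprema over compact subsets of charts of iterated derivatives.\<close>

definition distributions :: "(real^'n) set \<Rightarrow> ('n section_family \<Rightarrow> complex) set" where
  "distributions P = {u \<in> extensional (test_sections P).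
     (\<forall>\<tau>\<in>test_sections P. \<forall>\<tau>'\<in>test_sections P. u (\<lambda>v p. \<tau> v p + \<tau>' v p) = u \<tau> + u \<tau>') \<and>
     (\<forall>\<tau>\<in>test_sections P. \<forall>c. u (\<lambda>v p. c * \<tau> v p) = c * u \<tau>) \<and>
     (\<exists>C Q. finite Q \<and>
        (\<forall>(v, K, hs)\<in>Q. v \<in> vertices P \<and> compact K \<and> K \<subseteq> chart P v ` chart_dom P v) \<and>
        (\<forall>\<tau>\<in>test_sections P. \<forall>B\<ge>0.
           (\<forall>(v, K, hs)\<in>Q. \<forall>z\<in>K. cmod (iter_deriv hs (in_chart P v (\<tau> v)) z) \<le> B) \<longrightarrow>
           cmod (u \<tau>) \<le> C * B))}"

text \<open>The weak topology: pointwise convergence on test sections.\<close>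

definition distribution_topology ::
    "(real^'n) set \<Rightarrow> ('n section_family \<Rightarrow> complex) topology" where
  "distribution_topology P =
     subtopology (product_topology (\<lambda>_. euclidean) (test_sections P)) (distributions P)"

definition iota :: "(real^'n) set \<Rightarrow> 'n section_family \<Rightarrow> 'n section_family \<Rightarrow> complex" where
  "iota P s = restrict
     (\<lambda>\<tau>. liouville_integral P (\<lambda>p. s (vertex_at P p) p * \<tau> (vertex_at P p) p)) (test_sections P)"

text \<open>The covariant derivative, in the frame \<open>1\<^sub>v\<close> and in the coordinates \<open>(x, \<theta>)\<close> of
  the open orbit, along the tangent vector \<open>(a, b)\<close>.\<close>

definition nabla ::
    "(real^'n) set \<Rightarrow> real^'n \<Rightarrow> 'n section_family \<Rightarrow> (real^'n) \<times> (real^'n) \<Rightarrow>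
     (real^'n) \<times> (real^'n) \<Rightarrow> complex" where
  "nabla P v s q t =
     frechet_derivative (\<lambda>(x, \<theta>). s v (pt P x \<theta>)) (at q) t
       - \<i> * complex_of_real ((fst q - v) \<bullet> snd t) * s v (pt P (fst q) (snd q))"


section \<open>Symplectic potentials and complex structures\<close>

definition guillemin_potential :: "(real^'n) set \<Rightarrow> real^'n \<Rightarrow> real" where
  "guillemin_potential P x = (1 / 2) * (\<Sum>r\<in>facet_data P. ell r x * ln (ell r x))"

definition C_inf_gP :: "(real^'n) set \<Rightarrow> (real^'n \<Rightarrow> real) set" where
  "C_inf_gP P = {\<phi>. smooth_on_closed P \<phi> \<and>
     (\<forall>x\<in>interior P. pos_def (Hess (\<lambda>y. guillemin_potential P y + \<phi> y) x)) \<and>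
     (\<exists>\<alpha>. smooth_on_closed P \<alpha> \<and> (\<forall>x\<in>P. 0 < \<alpha> x) \<and>
        (\<forall>x\<in>interior P. det (Hess (\<lambda>y. guillemin_potential P y + \<phi> y) x) =
           inverse (\<alpha> x * (\<Prod>r\<in>facet_data P. ell r x))))}"

definition potential ::
    "(real^'n) set \<Rightarrow> (real^'n \<Rightarrow> real) \<Rightarrow> (real^'n \<Rightarrow> real) \<Rightarrow> real \<Rightarrow> real^'n \<Rightarrow> real" where
  "potential P \<phi> \<psi> s x = guillemin_potential P x + \<phi> x + s * \<psi> x"

text \<open>On the open orbit, in the coordinates \<open>(x, \<theta>)\<close>: the complex structure for which
  \<open>y + i \<theta>\<close>, \<open>y = grad g\<close>, is holomorphic, so that \<open>J \<partial>\<^sub>y = \<partial>\<^sub>\<theta>\<close>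
  and \<open>dy = Hess g dx\<close>.\<close>

definition cplx_str :: "(real^'n \<Rightarrow> real) \<Rightarrow> real^'n \<Rightarrow> (real^'n) \<times> (real^'n) \<Rightarrow> (real^'n) \<times> (real^'n)" where
  "cplx_str g x t = (- (matrix_inv (Hess g x) *v snd t), Hess g x *v fst t)"

text \<open>Smooth sections annihilated by the covariant derivative along all \<open>t + i J t\<close>. By density
  it suffices to demand this on the open orbit.\<close>

definition holomorphic_sections ::
    "(real^'n) set \<Rightarrow> (real^'n \<Rightarrow> real) \<Rightarrow> 'n section_family set" where
  "holomorphic_sections P g = {s \<in> smooth_sections P 1.
     \<forall>v\<in>vertices P. \<forall>x\<in>interior P. \<forall>\<theta> t.
       nabla P v s (x, \<theta>) t + \<i> * nabla P v s (x, \<theta>) (cplx_str g x t) = 0}"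


section \<open>Monomial sections and delta sections\<close>

definition h_fun :: "(real^'n \<Rightarrow> real) \<Rightarrow> real^'n \<Rightarrow> real^'n \<Rightarrow> real" where
  "h_fun g m x = (x - m) \<bullet> grad g x - g x"

text \<open>\<open>exp (- h)\<close> extended continuously to the boundary of \<open>P\<close>, where \<open>grad g\<close> is
  singular.\<close>

definition exp_neg_h :: "(real^'n) set \<Rightarrow> (real^'n \<Rightarrow> real) \<Rightarrow> real^'n \<Rightarrow> real^'n \<Rightarrow> real" where
  "exp_neg_h P g m x =
     (if x \<in> interior P then exp (- h_fun g m x)
      else Lim (at x within interior P) (\<lambda>x'. exp (- h_fun g m x')))"

definition phase :: "(real^'n) set \<Rightarrow> real^'n \<Rightarrow> real^'n \<Rightarrow> 'n point \<Rightarrow> complex" where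
  "phase P m v p = cis (ell_at P v m \<bullet> vartheta P v (angles p))"

text \<open>Where \<open>phase\<close> depends on the representative chosen by \<open>angles\<close>, the factor
  \<open>exp_neg_h\<close> vanishes.\<close>

definition monomial_section ::
    "(real^'n) set \<Rightarrow> (real^'n \<Rightarrow> real) \<Rightarrow> real^'n \<Rightarrow> 'n section_family" where
  "monomial_section P g m v p =
     (if v \<in> vertices P \<and> p \<in> chart_dom P v
      then complex_of_real (exp_neg_h P g m (moment p)) * phase P m v p else 0)"

definition normalized_section ::
    "(real^'n) set \<Rightarrow> (real^'n \<Rightarrow> real) \<Rightarrow> real^'n \<Rightarrow> 'n section_family" where
  "normalized_section P g m v p =
     monomial_section P g m v p / complex_of_real (L1_norm P (monomial_section P g m))"

definition delta_section :: "(real^'n) set \<Rightarrow> real^'n \<Rightarrow> 'n section_family \<Rightarrow> complex" where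
  "delta_section P m = restrict
     (\<lambda>\<tau>. let v = (SOME v. v \<in> vertices P \<and> orbit P m \<subseteq> chart_dom P v)
           in orbit_integral P m (\<lambda>p. phase P m v p * \<tau> v p)) (test_sections P)"

end

theory Submission
  imports Defs
begin

text \<open>
  On the open orbit the modulus of the monomial section is \<open>exp (- h x)\<close>, where \<open>h\<close> is affine in
  \<open>s\<close>: it is the contribution of \<open>g\<^sub>P + \<phi>\<close> plus \<open>s\<close> times \<open>f x = (x - m) \<bullet> grad \<psi> x - \<psi> x\<close>. The
  function \<open>f\<close> has the derivative \<open>(x - m) \<bullet> Hess \<psi> x a\<close> in the direction \<open>a\<close>, so it increases
  strictly along every ray issuing from \<open>m\<close> (\<open>h_fun_strict_min\<close>). The normalized weights
  \<open>exp (- h)\<close> are therefore probability densities that concentrate at \<open>m\<close> as \<open>s\<close> tends to infinity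
  (\<open>laplace_concentration\<close>). Paired with a test section, the angular factor of the monomial section
  gives a function that is continuous up to the orbit over \<open>m\<close>, uniformly in the angles; in the
  limit only its mean over that orbit survives, which is the delta section
  (\<open>iota_tendsto_delta\<close>).

  That the sections are smooth rests on a closed form (\<open>exp_neg_h_interior\<close>): the logarithms in the
  Guillemin potential turn \<open>exp (- h)\<close> into the product of the \<open>sqrt (l\<^sub>r x)\<close> to the power
  \<open>l\<^sub>r m\<close>, which is a natural number because \<open>m\<close> is a lattice point, times a smooth positive
  function. In the chart at a vertex the square roots combine with the phase into powers of the
  complex coordinates (\<open>monomial_section_chart\<close>). Holomorphy is a computation with the derivative of
  \<open>h\<close>, in which the gradient terms cancel (\<open>has_derivative_h_fun\<close>,
  \<open>normalized_section_holomorphic\<close>).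

  The geometry needed is that the charts are well defined and injective, with open images in the
  coordinate space. It comes from the unimodularity of the matrix of normals at a vertex, which identifies the
  ambiguity of the angles over \<open>x\<close> with the ambiguity of polar coordinates
  (\<open>angle_rel_vartheta\<close>, \<open>polar_inj\<close>, \<open>chart_image_eq\<close>). Continuity of the functionals follows from
  finitely many compact subsets of the charts that cover the manifold (\<open>compact_cover\<close>).
\<close>

section \<open>Calculus of smooth functions\<close>

text \<open>Smoothness quantifies over all lists of directions at once; a finite order of differentiability
  is what the inductions below can run on.\<close>

primrec diff_order :: "nat \<Rightarrow> 'a::real_normed_vector set \<Rightarrow> ('a \<Rightarrow> 'b::real_normed_vector) \<Rightarrow> bool" where
  "diff_order 0 S f \<longleftrightarrow> (\<forall>x\<in>S. f differentiable (at x))"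
| "diff_order (Suc n) S f \<longleftrightarrow> (\<forall>x\<in>S. f differentiable (at x)) \<and>
     (\<forall>h. diff_order n S (\<lambda>x. frechet_derivative f (at x) h))"

lemma diff_order_iff:
  "diff_order n S f \<longleftrightarrow> (\<forall>hs. length hs \<le> n \<longrightarrow> (\<forall>x\<in>S. iter_deriv hs f differentiable (at x)))"
proof (induction n arbitrary: f)
  case 0
  then show ?case by simp
next
  case (Suc n)
  have "(\<forall>hs. length hs \<le> Suc n \<longrightarrow> (\<forall>x\<in>S. iter_deriv hs f differentiable (at x))) \<longleftrightarrow>
    (\<forall>x\<in>S. f differentiable (at x)) \<and> (\<forall>h hs. length hs \<le> n \<longrightarrow>
       (\<forall>x\<in>S. iter_deriv (h # hs) f differentiable (at x)))" (is "?A \<longleftrightarrow> ?B")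
  proof
    assume ?A
    then show ?B
      by (metis Suc_le_mono iter_deriv.simps(1) le0 length_Cons list.size(3))
  next
    assume B: ?B
    show ?A
    proof (intro allI impI)
      fix hs :: "'a list" assume "length hs \<le> Suc n"
      then show "\<forall>x\<in>S. iter_deriv hs f differentiable (at x)"
        using B by (cases hs) auto
    qed
  qed
  then show ?case
    by (simp add: Suc.IH)
qed

lemma smooth_on_iff_diff_order: "smooth_on S f \<longleftrightarrow> (\<forall>n. diff_order n S f)"
  by (auto simp: smooth_on_def diff_order_iff)

lemma diff_order_imp_differentiable: "diff_order n S f \<Longrightarrow> x \<in> S \<Longrightarrow> f differentiable (at x)"
  by (cases n) auto

lemma smooth_on_imp_differentiable: "smooth_on S f \<Longrightarrow> x \<in> S \<Longrightarrow> f differentiable (at x)"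
  by (auto simp: smooth_on_iff_diff_order intro: diff_order_imp_differentiable)

lemma smooth_on_imp_has_derivative:
  "smooth_on S f \<Longrightarrow> x \<in> S \<Longrightarrow> (f has_derivative frechet_derivative f (at x)) (at x)"
  by (simp add: smooth_on_imp_differentiable frechet_derivative_works[THEN iffD1])

lemma smooth_on_imp_continuous_on: "smooth_on S f \<Longrightarrow> continuous_on S f"
  by (meson continuous_at_imp_continuous_on differentiable_imp_continuous_within
      smooth_on_imp_differentiable)

lemma smooth_on_deriv: "smooth_on S f \<Longrightarrow> smooth_on S (\<lambda>x. frechet_derivative f (at x) h)"
  unfolding smooth_on_iff_diff_order using diff_order.simps(2) by blast

lemma smooth_on_subset: "smooth_on T f \<Longrightarrow> S \<subseteq> T \<Longrightarrow> smooth_on S f"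
  by (auto simp: smooth_on_def)

lemma diff_order_Suc_imp: "diff_order (Suc n) S f \<Longrightarrow> diff_order n S f"
  by (simp add: diff_order_iff)

lemma differentiable_transform_open:
  assumes "open S" "x \<in> S" "\<And>y. y \<in> S \<Longrightarrow> f y = g y" "f differentiable (at x)"
  shows "g differentiable (at x)"
  using assms unfolding differentiable_def
  by (metis has_derivative_transform_within_open)

lemma frechet_derivative_cong_open:
  assumes "open S" "x \<in> S" "\<And>y. y \<in> S \<Longrightarrow> f y = g y"
  shows "frechet_derivative f (at x) = frechet_derivative g (at x)"
proof -
  have "(f has_derivative D) (at x) \<longleftrightarrow> (g has_derivative D) (at x)" for D
    using assms by (metis has_derivative_transform_within_open)
  then show ?thesis
    by (simp add: frechet_derivative_def)
qed

lemma diff_order_cong: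
  assumes "open S" "\<And>x. x \<in> S \<Longrightarrow> f x = g x" "diff_order n S f"
  shows "diff_order n S g"
  using assms(2,3)
proof (induction n arbitrary: f g)
  case 0
  then show ?case
    using differentiable_transform_open[OF assms(1)] by (metis diff_order.simps(1))
next
  case (Suc n)
  have "diff_order n S (\<lambda>x. frechet_derivative g (at x) h)" for h
  proof (rule Suc.IH)
    show "diff_order n S (\<lambda>x. frechet_derivative f (at x) h)"
      using Suc.prems by simp
    show "frechet_derivative f (at x) h = frechet_derivative g (at x) h" if "x \<in> S" for x
      using frechet_derivative_cong_open[OF assms(1) that, of f g] Suc.prems(1) by simp
  qed
  moreover have "\<forall>x\<in>S. g differentiable (at x)"
    using Suc.prems differentiable_transform_open[OF assms(1)] by (metis diff_order.simps(2))
  ultimately show ?case by simp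
qed

lemma smooth_on_cong:
  "open S \<Longrightarrow> (\<And>x. x \<in> S \<Longrightarrow> f x = g x) \<Longrightarrow> smooth_on S f \<Longrightarrow> smooth_on S g"
  unfolding smooth_on_iff_diff_order by (meson diff_order_cong)

text \<open>Derivatives are usually known through a formula \<open>f'\<close> valid on \<open>S\<close> only, whereas
  \<^const>\<open>frechet_derivative\<close> is a choice made at every point; on an open set the two are
  interchangeable.\<close>

lemma diff_order_SucI:
  assumes "open S" "\<And>x. x \<in> S \<Longrightarrow> (f has_derivative f' x) (at x)"
    and "\<And>h. diff_order n S (\<lambda>x. f' x h)"
  shows "diff_order (Suc n) S f"
proof -
  have "frechet_derivative f (at x) = f' x" if "x \<in> S" for x
    using assms(2)[OF that] by (metis frechet_derivative_at)
  then have "diff_order n S (\<lambda>x. frechet_derivative f (at x) h)" for h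
    by (intro diff_order_cong[OF assms(1) _ assms(3)]) auto
  then show ?thesis
    using assms(2) by (auto simp: differentiable_def)
qed

lemma diff_order_const: "open S \<Longrightarrow> diff_order n S (\<lambda>x. c)"
proof (induction n arbitrary: c)
  case (Suc n)
  then show ?case
    by (intro diff_order_SucI[where f' = "\<lambda>x h. 0"]) (auto intro: has_derivative_const)
qed simp

lemma diff_order_add:
  assumes "open S" "diff_order n S f" "diff_order n S g"
  shows "diff_order n S (\<lambda>x. f x + g x)"
  using assms(2,3)
proof (induction n arbitrary: f g)
  case (Suc n)
  then show ?case
    by (intro diff_order_SucI[where f' = "\<lambda>x h. frechet_derivative f (at x) h + frechet_derivative g (at x) h"]
        assms has_derivative_add) (auto simp: frechet_derivative_works[THEN iffD1])
qed auto

lemma diff_order_bilinear: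
  assumes "bounded_bilinear B" "open S" "diff_order n S f" "diff_order n S g"
  shows "diff_order n S (\<lambda>x. B (f x) (g x))"
  using assms(3,4)
proof (induction n arbitrary: f g)
  case 0
  then show ?case
    unfolding diff_order.simps differentiable_def by (blast intro: bounded_bilinear.FDERIV[OF assms(1)])
next
  case (Suc n)
  have "((\<lambda>x. B (f x) (g x)) has_derivative (\<lambda>h. B (f x) (frechet_derivative g (at x) h) +
          B (frechet_derivative f (at x) h) (g x))) (at x)" if "x \<in> S" for x
    using Suc.prems that
    by (intro bounded_bilinear.FDERIV[OF assms(1)] frechet_derivative_works[THEN iffD1]) auto
  moreover have "diff_order n S (\<lambda>x. B (f x) (frechet_derivative g (at x) h) +
          B (frechet_derivative f (at x) h) (g x))" for h
    using Suc.prems diff_order_Suc_imp[OF Suc.prems(1)] diff_order_Suc_imp[OF Suc.prems(2)]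
    by (intro diff_order_add[OF assms(2)] Suc.IH) auto
  ultimately show ?case
    by (rule diff_order_SucI[OF assms(2)])
qed

lemma diff_order_linear_image:
  assumes "bounded_linear L" "open S" "diff_order n S f"
  shows "diff_order n S (\<lambda>x. L (f x))"
  using assms(3)
proof (induction n arbitrary: f)
  case 0
  then show ?case
    unfolding diff_order.simps differentiable_def by (blast intro: bounded_linear.has_derivative[OF assms(1)])
next
  case (Suc n)
  have "((\<lambda>x. L (f x)) has_derivative (\<lambda>h. L (frechet_derivative f (at x) h))) (at x)" if "x \<in> S" for x
    using Suc.prems that
    by (intro bounded_linear.has_derivative[OF assms(1)] frechet_derivative_works[THEN iffD1]) auto
  moreover have "diff_order n S (\<lambda>x. L (frechet_derivative f (at x) h))" for h
    using Suc.prems by (intro Suc.IH) auto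
  ultimately show ?case
    by (rule diff_order_SucI[OF assms(2)])
qed

lemma diff_order_id: "open S \<Longrightarrow> diff_order n S (\<lambda>x. x)"
proof (cases n)
  case (Suc k)
  assume "open S"
  then show ?thesis
    unfolding Suc by (intro diff_order_SucI[where f' = "\<lambda>x h. h"] diff_order_const) (auto intro: has_derivative_ident)
qed auto

lemma diff_order_sum:
  assumes "open S" "finite I" "\<And>i. i \<in> I \<Longrightarrow> diff_order n S (f i)"
  shows "diff_order n S (\<lambda>x. \<Sum>i\<in>I. f i x)"
  using assms(2,3)
  by (induction I rule: finite_induct) (auto intro!: diff_order_add diff_order_const assms(1))

text \<open>Expanding the outer derivative in a basis of the intermediate space writes the derivative
  of a composition as a sum of products of functions to which the induction applies.\<close>

lemma diff_order_compose:
  fixes f :: "'a::real_normed_vector \<Rightarrow> 'b::euclidean_space"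
  assumes "open S" "f ` S \<subseteq> T" "diff_order n S f" "diff_order n T g"
  shows "diff_order n S (\<lambda>x. g (f x))"
  using assms(3,4)
proof (induction n arbitrary: g)
  case 0
  then show ?case
    using assms(2) differentiable_chain_at[of f _ g] by (auto simp: image_subset_iff comp_def)
next
  case (Suc n)
  let ?f' = "\<lambda>x h. frechet_derivative f (at x) h"
  let ?g' = "\<lambda>y h. frechet_derivative g (at y) h"
  have fS: "f x \<in> T" if "x \<in> S" for x using assms(2) that by auto
  have d: "((\<lambda>x. g (f x)) has_derivative (\<lambda>h. \<Sum>b\<in>Basis. (?f' x h \<bullet> b) *\<^sub>R ?g' (f x) b)) (at x)"
    if "x \<in> S" for x
  proof -
    have g: "(g has_derivative ?g' (f x)) (at (f x))"
      using Suc.prems fS[OF that] by (auto simp: frechet_derivative_works[THEN iffD1])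
    have f: "(f has_derivative ?f' x) (at x)"
      using Suc.prems that by (auto simp: frechet_derivative_works[THEN iffD1])
    have rep: "?g' (f x) u = (\<Sum>b\<in>Basis. (u \<bullet> b) *\<^sub>R ?g' (f x) b)" for u
    proof -
      have L: "linear (?g' (f x))" using g has_derivative_linear by blast
      have rep: "?g' (f x) u = ?g' (f x) (\<Sum>b\<in>Basis. (u \<bullet> b) *\<^sub>R b)" by (simp add: euclidean_representation)
      then show ?thesis
        by (simp add: linear_sum[OF L] linear_scale[OF L])
    qed
    show ?thesis
      unfolding rep[symmetric] by (rule has_derivative_compose[OF f g])
  qed
  have "diff_order n S (\<lambda>x. \<Sum>b\<in>Basis. (?f' x h \<bullet> b) *\<^sub>R ?g' (f x) b)" for h
  proof (intro diff_order_sum assms(1) finite_Basis diff_order_bilinear[OF bounded_bilinear_scaleR])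
    fix b :: 'b
    show "diff_order n S (\<lambda>x. ?f' x h \<bullet> b)"
      using Suc.prems by (intro diff_order_linear_image[OF bounded_linear_inner_left] assms(1)) auto
    show "diff_order n S (\<lambda>x. ?g' (f x) b)"
      using Suc.prems diff_order_Suc_imp[OF Suc.prems(1)] by (intro Suc.IH) auto
  qed
  then show ?case
    by (intro diff_order_SucI[where f' = "\<lambda>x h. \<Sum>b\<in>Basis. (?f' x h \<bullet> b) *\<^sub>R ?g' (f x) b"] assms(1) d)
qed

lemma smooth_on_const: "open S \<Longrightarrow> smooth_on S (\<lambda>x. c)"
  by (simp add: smooth_on_iff_diff_order diff_order_const)

lemma smooth_on_id: "open S \<Longrightarrow> smooth_on S (\<lambda>x. x)"
  by (simp add: smooth_on_iff_diff_order diff_order_id)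

lemma smooth_on_add: "open S \<Longrightarrow> smooth_on S f \<Longrightarrow> smooth_on S g \<Longrightarrow> smooth_on S (\<lambda>x. f x + g x)"
  by (simp add: smooth_on_iff_diff_order diff_order_add)

lemma smooth_on_linear_image: "bounded_linear L \<Longrightarrow> open S \<Longrightarrow> smooth_on S f \<Longrightarrow> smooth_on S (\<lambda>x. L (f x))"
  by (simp add: smooth_on_iff_diff_order diff_order_linear_image)

lemma smooth_on_diff:
  assumes "open S" "smooth_on S f" "smooth_on S g"
  shows "smooth_on S (\<lambda>x. f x - g x)"
proof -
  have "smooth_on S (\<lambda>x. - g x)"
    using assms by (intro smooth_on_linear_image[OF bounded_linear_minus[OF bounded_linear_ident]])
  then show ?thesis
    using smooth_on_add[OF assms(1,2)] by fastforce
qed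

lemma smooth_on_linear: "bounded_linear L \<Longrightarrow> open S \<Longrightarrow> smooth_on S L"
  using smooth_on_linear_image[of L S "\<lambda>x. x"] smooth_on_id[of S] by simp

lemma smooth_on_bilinear:
  "bounded_bilinear B \<Longrightarrow> open S \<Longrightarrow> smooth_on S f \<Longrightarrow> smooth_on S g \<Longrightarrow> smooth_on S (\<lambda>x. B (f x) (g x))"
  by (simp add: smooth_on_iff_diff_order diff_order_bilinear)

lemma smooth_on_mult:
  fixes f g :: "'a::real_normed_vector \<Rightarrow> 'b::real_normed_algebra"
  shows "open S \<Longrightarrow> smooth_on S f \<Longrightarrow> smooth_on S g \<Longrightarrow> smooth_on S (\<lambda>x. f x * g x)"
  by (rule smooth_on_bilinear[OF bounded_bilinear_mult])

lemma smooth_on_sum: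
  "open S \<Longrightarrow> finite I \<Longrightarrow> (\<And>i. i \<in> I \<Longrightarrow> smooth_on S (f i)) \<Longrightarrow> smooth_on S (\<lambda>x. \<Sum>i\<in>I. f i x)"
  by (simp add: smooth_on_iff_diff_order diff_order_sum)

lemma smooth_on_prod:
  fixes f :: "'i \<Rightarrow> 'a::real_normed_vector \<Rightarrow> 'b::real_normed_field"
  assumes "open S" "finite I" "\<And>i. i \<in> I \<Longrightarrow> smooth_on S (f i)"
  shows "smooth_on S (\<lambda>x. \<Prod>i\<in>I. f i x)"
  using assms(2,3)
  by (induction I rule: finite_induct) (auto intro!: smooth_on_mult smooth_on_const assms(1))

lemma smooth_on_power:
  fixes f :: "'a::real_normed_vector \<Rightarrow> 'b::real_normed_field"
  assumes "open S" "smooth_on S f"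
  shows "smooth_on S (\<lambda>x. f x ^ n)"
  by (induction n) (auto intro!: smooth_on_mult smooth_on_const assms)

lemma smooth_on_compose:
  fixes f :: "'a::real_normed_vector \<Rightarrow> 'b::euclidean_space"
  shows "open S \<Longrightarrow> f ` S \<subseteq> T \<Longrightarrow> smooth_on S f \<Longrightarrow> smooth_on T g \<Longrightarrow> smooth_on S (\<lambda>x. g (f x))"
  by (simp add: smooth_on_iff_diff_order diff_order_compose)

lemma smooth_on_vec:
  fixes f :: "'a::real_normed_vector \<Rightarrow> real^'n"
  assumes "open S" "\<And>i. smooth_on S (\<lambda>x. f x $ i)"
  shows "smooth_on S f"
proof -
  have "smooth_on S (\<lambda>x. \<Sum>i\<in>UNIV. f x $ i *\<^sub>R axis i (1::real))"
    using assms by (intro smooth_on_sum smooth_on_bilinear[OF bounded_bilinear_scaleR] smooth_on_const) auto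
  moreover have "(\<Sum>i\<in>UNIV. f x $ i *\<^sub>R axis i (1::real)) = f x" for x
    using basis_expansion[of "f x"] by (simp add: scalar_mult_eq_scaleR)
  ultimately show ?thesis by simp
qed

lemma smooth_on_exp: "smooth_on UNIV (exp :: real \<Rightarrow> real)"
proof -
  have "diff_order n UNIV (exp :: real \<Rightarrow> real)" for n
  proof (induction n)
    case 0
    then show ?case by (auto simp: differentiable_def intro!: exI derivative_eq_intros)
  next
    case (Suc n)
    then show ?case
      by (intro diff_order_SucI[where f' = "\<lambda>x h. h * exp x"] diff_order_linear_image[OF bounded_linear_mult_right])
         (auto intro!: derivative_eq_intros)
  qed
  then show ?thesis by (simp add: smooth_on_iff_diff_order)
qed

lemma smooth_on_inverse: "smooth_on {0<..} (inverse :: real \<Rightarrow> real)"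
proof -
  have "diff_order n {0<..} (inverse :: real \<Rightarrow> real)" for n
  proof (induction n)
    case 0
    then show ?case by (auto simp: differentiable_def intro!: exI derivative_eq_intros)
  next
    case (Suc n)
    have "diff_order n {0<..} (\<lambda>x. (- h) * (inverse x * inverse x))" for h :: real
      using Suc.IH
      by (intro diff_order_linear_image[OF bounded_linear_mult_right] diff_order_bilinear[OF bounded_bilinear_mult]) auto
    moreover have "(inverse has_derivative (\<lambda>h. (- h) * (inverse x * inverse x))) (at x)" if "x \<in> {0<..}" for x :: real
      using that by (auto intro!: derivative_eq_intros)
    ultimately show ?case
      by (intro diff_order_SucI[where S = "{0<..}" and f' = "\<lambda>x h. (- h) * (inverse x * inverse x)"]) auto
  qed
  then show ?thesis by (simp add: smooth_on_iff_diff_order)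
qed

lemma smooth_on_ln: "smooth_on {0<..} (ln :: real \<Rightarrow> real)"
proof -
  have "diff_order n {0<..} (ln :: real \<Rightarrow> real)" for n
  proof (cases n)
    case 0
    then show ?thesis by (auto simp: differentiable_def intro!: exI derivative_eq_intros)
  next
    case (Suc k)
    have "diff_order k {0<..} (\<lambda>x. h * inverse x)" for h :: real
      using smooth_on_inverse
      by (intro diff_order_linear_image[OF bounded_linear_mult_right]) (auto simp: smooth_on_iff_diff_order)
    moreover have "(ln has_derivative (\<lambda>h. h * inverse x)) (at x)" if "x \<in> {0<..}" for x :: real
      using that by (auto intro!: derivative_eq_intros)
    ultimately show ?thesis
      unfolding Suc by (intro diff_order_SucI[where S = "{0<..}" and f' = "\<lambda>x h. h * inverse x"]) auto
  qed
  then show ?thesis by (simp add: smooth_on_iff_diff_order)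
qed

text \<open>Writing the square root as an exponential keeps the argument away from the singularity.\<close>

lemma smooth_on_sqrt: "smooth_on {0<..} (sqrt :: real \<Rightarrow> real)"
proof (rule smooth_on_cong)
  show "smooth_on {0<..} (\<lambda>x::real. exp ((1/2) * ln x))"
    using smooth_on_compose[OF open_greaterThan _
        smooth_on_linear_image[OF bounded_linear_mult_right[of "1/2"] open_greaterThan smooth_on_ln] smooth_on_exp]
    by simp
  show "exp ((1/2) * ln x) = sqrt x" if "x \<in> {0<..}" for x :: real
    using that by (simp add: powr_half_sqrt[symmetric] powr_def)
qed auto

section \<open>Gradients, Hessians and the Legendre-type function\<close>

lemma frechet_derivative_eq_grad:
  fixes g :: "real^'n \<Rightarrow> real"
  assumes "g differentiable (at x)"
  shows "frechet_derivative g (at x) u = grad g x \<bullet> u"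
proof -
  have L: "linear (frechet_derivative g (at x))"
    using assms by (rule linear_frechet_derivative)
  have "frechet_derivative g (at x) (\<Sum>i\<in>UNIV. (u $ i) *\<^sub>R axis i 1) = grad g x \<bullet> u"
    by (simp add: linear_sum[OF L] linear_scale[OF L] grad_def inner_vec_def mult.commute)
  moreover have "(\<Sum>i\<in>UNIV. (u $ i) *\<^sub>R axis i (1::real)) = u"
    using basis_expansion[of u] by (simp add: scalar_mult_eq_scaleR)
  ultimately show ?thesis by simp
qed

lemma grad_eqI:
  fixes g :: "real^'n \<Rightarrow> real"
  assumes "(g has_derivative (\<lambda>u. a \<bullet> u)) (at x)"
  shows "grad g x = a"
  by (simp add: frechet_derivative_at[OF assms, symmetric] grad_def vec_eq_iff inner_axis)

lemma has_derivative_grad_inner: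
  fixes g :: "real^'n \<Rightarrow> real"
  assumes "g differentiable (at x)"
  shows "(g has_derivative (\<lambda>u. grad g x \<bullet> u)) (at x)"
proof -
  have "frechet_derivative g (at x) = (\<lambda>u. grad g x \<bullet> u)"
    using frechet_derivative_eq_grad[OF assms] by blast
  then show ?thesis
    using assms frechet_derivative_works by metis
qed

lemma grad_add:
  fixes f g :: "real^'n \<Rightarrow> real"
  assumes "f differentiable (at x)" "g differentiable (at x)"
  shows "grad (\<lambda>y. f y + g y) x = grad f x + grad g x"
  by (rule grad_eqI) (use has_derivative_add[OF assms[THEN has_derivative_grad_inner]] in \<open>simp add: inner_add_left\<close>)

lemma grad_scale:
  fixes g :: "real^'n \<Rightarrow> real"
  assumes "g differentiable (at x)"
  shows "grad (\<lambda>y. c * g y) x = c *\<^sub>R grad g x"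
  by (rule grad_eqI) (use has_derivative_mult_right[OF has_derivative_grad_inner[OF assms], of c] in simp)

lemma smooth_on_grad:
  fixes g :: "real^'n \<Rightarrow> real"
  assumes "open S" "smooth_on S g"
  shows "smooth_on S (grad g)"
  by (rule smooth_on_vec[OF assms(1)]) (simp add: grad_def smooth_on_deriv[OF assms(2)])

lemma has_derivative_grad:
  fixes g :: "real^'n \<Rightarrow> real"
  assumes "open S" "smooth_on S g" "x \<in> S"
  shows "(grad g has_derivative (\<lambda>a. Hess g x *v a)) (at x)"
proof -
  obtain D where D: "(grad g has_derivative D) (at x)"
    using smooth_on_imp_has_derivative[OF smooth_on_grad[OF assms(1,2)] assms(3)] by blast
  have L: "linear D" using D has_derivative_linear by blast
  have "((\<lambda>y. grad g y $ i) has_derivative (\<lambda>a. D a $ i)) (at x)" for i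
    by (rule bounded_linear.has_derivative[OF bounded_linear_vec_nth D])
  then have H: "Hess g x $ i $ j = D (axis j 1) $ i" for i j
    using frechet_derivative_at[of "\<lambda>y. grad g y $ i"] by (simp add: Hess_def) metis
  have "Hess g x *v a = D a" for a
  proof -
    have "D (\<Sum>j\<in>UNIV. (a $ j) *\<^sub>R axis j 1) = Hess g x *v a"
      by (simp add: linear_sum[OF L] linear_scale[OF L] vec_eq_iff matrix_vector_mult_def H mult.commute)
    moreover have "(\<Sum>j\<in>UNIV. (a $ j) *\<^sub>R axis j (1::real)) = a"
      using basis_expansion[of a] by (simp add: scalar_mult_eq_scaleR)
    ultimately show ?thesis by simp
  qed
  then show ?thesis using D by (simp add: fun_eq_iff[symmetric])
qed

lemma Hess_eqI:
  fixes g :: "real^'n \<Rightarrow> real"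
  assumes "(grad g has_derivative (\<lambda>a. A *v a)) (at x)"
  shows "Hess g x = A"
proof -
  have "((\<lambda>y. grad g y $ i) has_derivative (\<lambda>a. (A *v a) $ i)) (at x)" for i
    by (rule bounded_linear.has_derivative[OF bounded_linear_vec_nth assms])
  then have "Hess g x $ i $ j = (A *v axis j 1) $ i" for i j
    using frechet_derivative_at[of "\<lambda>y. grad g y $ i"] by (simp add: Hess_def) metis
  then show ?thesis
    by (simp add: vec_eq_iff matrix_vector_mul_component inner_axis)
qed

lemma Hess_add_scale:
  fixes f g :: "real^'n \<Rightarrow> real"
  assumes "open S" "smooth_on S f" "smooth_on S g" "x \<in> S"
  shows "Hess (\<lambda>y. f y + c * g y) x = Hess f x + c *\<^sub>R Hess g x"
proof (rule Hess_eqI)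
  have "((\<lambda>y. grad f y + c *\<^sub>R grad g y) has_derivative (\<lambda>a. (Hess f x + c *\<^sub>R Hess g x) *v a)) (at x)"
    using has_derivative_add[OF has_derivative_grad[OF assms(1,2,4)]
        has_derivative_scaleR_right[OF has_derivative_grad[OF assms(1,3,4)], of c]]
    by (simp add: matrix_vector_mult_add_rdistrib scaleR_matrix_vector_assoc)
  moreover have "grad (\<lambda>y. f y + c * g y) y = grad f y + c *\<^sub>R grad g y" if "y \<in> S" for y
  proof -
    have d: "f differentiable (at y)" "g differentiable (at y)"
      using assms(2,3) that by (auto intro: smooth_on_imp_differentiable)
    then have "(\<lambda>y. c * g y) differentiable (at y)"
      by (simp add: differentiable_cmult_left_iff)
    then show ?thesis using d by (simp add: grad_add grad_scale)
  qed
  ultimately show "(grad (\<lambda>y. f y + c * g y) has_derivative (\<lambda>a. (Hess f x + c *\<^sub>R Hess g x) *v a)) (at x)"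
    using has_derivative_transform_within_open[OF _ assms(1,4)] by (metis (no_types, lifting))
qed

lemma h_fun_add_scale:
  fixes f g :: "real^'n \<Rightarrow> real"
  assumes "f differentiable (at x)" "g differentiable (at x)"
  shows "h_fun (\<lambda>y. f y + c * g y) m x = h_fun f m x + c * h_fun g m x"
proof -
  have "(\<lambda>y. c * g y) differentiable (at x)"
    using assms by (simp add: differentiable_cmult_left_iff)
  then show ?thesis
    using assms by (simp add: h_fun_def grad_add grad_scale inner_add_right algebra_simps)
qed

lemma h_fun_cong_open:
  assumes "open S" "x \<in> S" "\<And>y. y \<in> S \<Longrightarrow> f y = g y"
  shows "h_fun f m x = h_fun g m x"
  using frechet_derivative_cong_open[OF assms] assms(2,3) by (simp add: h_fun_def grad_def)

lemma smooth_on_h_fun: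
  fixes g :: "real^'n \<Rightarrow> real"
  assumes "open S" "smooth_on S g"
  shows "smooth_on S (h_fun g m)"
proof -
  have "smooth_on S (\<lambda>x. (x - m) \<bullet> grad g x - g x)"
    by (intro smooth_on_diff smooth_on_bilinear[OF bounded_bilinear_inner] smooth_on_id smooth_on_const
        smooth_on_grad assms)
  then show ?thesis by (simp add: h_fun_def[abs_def])
qed

text \<open>The gradient terms cancel, so only the Hessian survives: this is behind both the
  holomorphy of the monomial sections and the growth of \<open>h_fun \<psi> m\<close> along rays issuing from \<open>m\<close>.\<close>

lemma has_derivative_h_fun:
  fixes g :: "real^'n \<Rightarrow> real"
  assumes "open S" "smooth_on S g" "x \<in> S"
  shows "(h_fun g m has_derivative (\<lambda>a. (x - m) \<bullet> (Hess g x *v a))) (at x)"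
proof -
  have "((\<lambda>y. (y - m) \<bullet> grad g y - g y) has_derivative
      (\<lambda>a. ((x - m) \<bullet> (Hess g x *v a) + (a - 0) \<bullet> grad g x) - grad g x \<bullet> a)) (at x)"
    by (intro has_derivative_diff has_derivative_inner has_derivative_ident has_derivative_const
        has_derivative_grad[OF assms] has_derivative_grad_inner smooth_on_imp_differentiable[OF assms(2,3)])
  then show ?thesis
    by (simp add: h_fun_def[abs_def] inner_commute)
qed

text \<open>At time \<open>t\<close> on the ray from \<open>m\<close> to \<open>x\<close> the derivative of \<open>h_fun \<psi> m\<close> is \<open>t\<close> times the
  Hessian form of \<open>\<psi>\<close> in the direction \<open>x - m\<close>, hence positive. This is the strict convexity that
  drives the concentration at \<open>m\<close>.\<close>

lemma h_fun_strict_min: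
  fixes \<psi> :: "real^'n \<Rightarrow> real"
  assumes U: "open U" "P \<subseteq> U" "smooth_on U \<psi>" "\<And>x. x \<in> U \<Longrightarrow> pos_def (Hess \<psi> x)"
    and P: "convex P" "m \<in> P" "x \<in> P" "x \<noteq> m"
  shows "h_fun \<psi> m m < h_fun \<psi> m x"
proof -
  define c where "c = (\<lambda>t. m + t *\<^sub>R (x - m))"
  have cU: "c t \<in> U" if "0 \<le> t" "t \<le> 1" for t
  proof -
    have "c t = (1 - t) *\<^sub>R m + t *\<^sub>R x" by (simp add: c_def algebra_simps)
    then show ?thesis using P that U(2) convexD[of P m x "1 - t" t] by auto
  qed
  have d: "((\<lambda>t. h_fun \<psi> m (c t)) has_real_derivative t * ((x - m) \<bullet> (Hess \<psi> (c t) *v (x - m)))) (at t)"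
    if "0 \<le> t" "t \<le> 1" for t
  proof -
    have c: "(c has_derivative (\<lambda>r. r *\<^sub>R (x - m))) (at t)"
      unfolding c_def by (auto intro!: derivative_eq_intros)
    have D: "((\<lambda>t. h_fun \<psi> m (c t)) has_derivative
        (\<lambda>r. (c t - m) \<bullet> (Hess \<psi> (c t) *v (r *\<^sub>R (x - m))))) (at t)"
      by (rule has_derivative_compose[OF c has_derivative_h_fun[OF U(1,3) cU[OF that]]])
    have "c t - m = t *\<^sub>R (x - m)" by (simp add: c_def)
    then show ?thesis
      unfolding has_field_derivative_def
      by (intro has_derivative_eq_rhs[OF D]) (simp add: fun_eq_iff matrix_vector_mult_scaleR)
  qed
  have "h_fun \<psi> m (c 0) < h_fun \<psi> m (c 1)"
  proof (rule DERIV_pos_imp_increasing_open[where f = "\<lambda>t. h_fun \<psi> m (c t)"])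
    fix t :: real assume t: "0 < t" "t < 1"
    have "0 < (x - m) \<bullet> (Hess \<psi> (c t) *v (x - m))"
      using U(4)[OF cU] t P(4) by (simp add: pos_def_def)
    then show "\<exists>y. ((\<lambda>t. h_fun \<psi> m (c t)) has_real_derivative y) (at t) \<and> 0 < y"
      using d[of t] t by auto
  next
    show "continuous_on {0..1} (\<lambda>t. h_fun \<psi> m (c t))"
      using DERIV_isCont[OF d] by (intro continuous_at_imp_continuous_on) auto
  qed simp
  then show ?thesis by (simp add: c_def)
qed

lemma pos_def_add_scale:
  assumes "pos_def A" "pos_def B" "0 < c"
  shows "pos_def (A + c *\<^sub>R B)"
proof -
  have "transpose (A + c *\<^sub>R B) = A + c *\<^sub>R B"
    using assms by (simp add: pos_def_def transpose_def vec_eq_iff)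
  moreover have "u \<bullet> ((A + c *\<^sub>R B) *v u) = u \<bullet> (A *v u) + c * (u \<bullet> (B *v u))" for u
    by (simp add: matrix_vector_mult_add_rdistrib scaleR_matrix_vector_assoc[symmetric] inner_add_right)
  ultimately show ?thesis
    using assms by (simp add: pos_def_def add_pos_pos)
qed

lemma pos_def_invertible: "pos_def H \<Longrightarrow> invertible H"
  unfolding invertible_left_inverse matrix_left_invertible_ker pos_def_def
  by (metis inner_zero_right less_irrefl)

section \<open>Concentration of exponential weights\<close>

text \<open>Laplace's principle: outside a sublevel set \<open>F < c + \<eta>\<close> the weight is at most of order
  \<open>exp (- s (c + \<eta>))\<close>, while the total mass is at least of order \<open>exp (- s (c + \<eta> / 2))\<close>
  because the smaller sublevel set \<open>F < c + \<eta> / 2\<close> has positive measure.\<close>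

lemma laplace_concentration:
  fixes W F :: "'a \<Rightarrow> real" and D :: "'a \<Rightarrow> 'b::{banach, second_countable_topology}"
  assumes "finite_measure M"
    and meas [measurable]: "W \<in> borel_measurable M" "F \<in> borel_measurable M" "D \<in> borel_measurable M"
    and W: "\<And>q. q \<in> space M \<Longrightarrow> 0 < W q" "\<And>q. q \<in> space M \<Longrightarrow> W q \<le> C"
    and F: "\<And>q. q \<in> space M \<Longrightarrow> c \<le> F q"
    and D: "\<And>q. q \<in> space M \<Longrightarrow> norm (D q) \<le> B"
    and small: "\<And>e. 0 < e \<Longrightarrow> \<exists>\<eta>>0. \<forall>q\<in>space M. F q < c + \<eta> \<longrightarrow> norm (D q) \<le> e"
    and pos: "\<And>\<eta>. 0 < \<eta> \<Longrightarrow> 0 < measure M {q \<in> space M. F q < c + \<eta>}"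
  shows "((\<lambda>s. (\<integral>q. (W q * exp (- s * F q)) *\<^sub>R D q \<partial>M) /\<^sub>R (\<integral>q. W q * exp (- s * F q) \<partial>M)) \<longlongrightarrow> 0) at_top"
proof -
  interpret finite_measure M by fact
  define K where "K = (\<lambda>s q. W q * exp (- s * (F q - c)))"
  have [measurable]: "K s \<in> borel_measurable M" for s unfolding K_def by measurable
  have K: "0 < K s q" "K s q \<le> C" if "0 \<le> s" "q \<in> space M" for s q
  proof -
    show "0 < K s q" using W(1)[OF that(2)] by (simp add: K_def)
    have "W q * exp (- s * (F q - c)) \<le> C * 1"
      using W[OF that(2)] F[OF that(2)] that(1) by (intro mult_mono) auto
    then show "K s q \<le> C" by (simp add: K_def)
  qed
  have intK: "integrable M (K s)" if "0 \<le> s" for s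
    using K[OF that] by (intro integrable_const_bound[where B = C]) (auto intro!: AE_I2 simp: abs_of_pos)
  have scale: "(\<integral>q. (W q * exp (- s * F q)) *\<^sub>R D q \<partial>M) /\<^sub>R (\<integral>q. W q * exp (- s * F q) \<partial>M)
      = (\<integral>q. K s q *\<^sub>R D q \<partial>M) /\<^sub>R (\<integral>q. K s q \<partial>M)" for s
  proof -
    have "W q * exp (- s * F q) = exp (- s * c) * K s q" for q
      by (simp add: K_def exp_add[symmetric] algebra_simps)
    then show ?thesis
      by (simp add: scaleR_scaleR[symmetric] del: scaleR_scaleR)
         (simp add: divide_simps)
  qed
  have "((\<lambda>s. (\<integral>q. K s q *\<^sub>R D q \<partial>M) /\<^sub>R (\<integral>q. K s q \<partial>M)) \<longlongrightarrow> 0) at_top"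
  proof (rule tendstoI)
    fix e :: real assume e: "0 < e"
    obtain \<eta> where \<eta>: "0 < \<eta>" "\<And>q. q \<in> space M \<Longrightarrow> F q < c + \<eta> \<Longrightarrow> norm (D q) \<le> e / 2"
      using small[of "e / 2"] e by auto
    define A where "A = {q \<in> space M. F q < c + \<eta> / 2}"
    have A [measurable]: "A \<in> sets M" unfolding A_def by measurable
    define a where "a = (\<integral>q. W q * indicator A q \<partial>M)"
    define b where "b = B * C * measure M (space M)"
    have intA: "integrable M (\<lambda>q. W q * indicator A q)"
      using W by (intro integrable_const_bound[where B = "\<bar>C\<bar>"])
        (force intro!: AE_I2 simp: indicator_def abs_if less_imp_le)+
    have a: "0 < a"
    proof (rule ccontr)
      assume "\<not> 0 < a"
      moreover have nn: "AE q in M. 0 \<le> W q * indicator A q"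
        using W by (intro AE_I2) (auto simp: indicator_def less_imp_le)
      ultimately have "a = 0"
        using integral_nonneg_AE[OF nn] by (simp add: a_def)
      then have "AE q in M. W q * indicator A q = 0"
        using integral_nonneg_eq_0_iff_AE[OF intA nn] by (simp add: a_def)
      then have "AE q in M. q \<notin> A"
        by (rule AE_mp) (intro AE_I2, use W(1) in \<open>force simp: indicator_def split: if_splits\<close>)
      then have "emeasure M A = 0"
        by (subst (asm) AE_iff_measurable[OF A]) (auto simp: A_def)
      then show False
        using pos[of "\<eta> / 2"] \<eta>(1) by (simp add: A_def measure_def)
    qed
    have lower: "exp (- s * (\<eta> / 2)) * a \<le> (\<integral>q. K s q \<partial>M)" if s: "0 \<le> s" for s
    proof -
      have "exp (- s * (\<eta> / 2)) * (W q * indicator A q) \<le> K s q" if q: "q \<in> space M" for q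
      proof (cases "q \<in> A")
        case True
        then have "s * (F q - c) \<le> s * (\<eta> / 2)" using s by (intro mult_left_mono) (auto simp: A_def)
        then have "exp (- s * (\<eta> / 2)) \<le> exp (- s * (F q - c))" by simp
        then show ?thesis
          using True W(1)[OF q] by (simp add: K_def mult.commute mult_left_mono)
      next
        case False
        then show ?thesis using K(1)[OF s q] by simp
      qed
      then have "(\<integral>q. exp (- s * (\<eta> / 2)) * (W q * indicator A q) \<partial>M) \<le> (\<integral>q. K s q \<partial>M)"
        using intA intK[OF s] by (intro integral_mono) auto
      then show ?thesis by (simp add: a_def)
    qed
    have upper: "norm (\<integral>q. K s q *\<^sub>R D q \<partial>M) \<le> e / 2 * (\<integral>q. K s q \<partial>M) + b * exp (- s * \<eta>)"
      if s: "0 \<le> s" for s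
    proof -
      have "norm (\<integral>q. K s q *\<^sub>R D q \<partial>M) \<le> (\<integral>q. norm (K s q *\<^sub>R D q) \<partial>M)"
        by (rule integral_norm_bound)
      also have "\<dots> \<le> (\<integral>q. e / 2 * K s q + B * C * exp (- s * \<eta>) \<partial>M)"
      proof (rule integral_mono_AE')
        show "integrable M (\<lambda>q. e / 2 * K s q + B * C * exp (- s * \<eta>))"
          using intK[OF s] by simp
        show bound: "AE q in M. norm (K s q *\<^sub>R D q) \<le> e / 2 * K s q + B * C * exp (- s * \<eta>)"
        proof (rule AE_I2)
          fix q assume q: "q \<in> space M"
          have B: "0 \<le> B" "0 \<le> C" using D[OF q] W[OF q] norm_ge_zero[of "D q"] by linarith+
          show "norm (K s q *\<^sub>R D q) \<le> e / 2 * K s q + B * C * exp (- s * \<eta>)"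
          proof (cases "F q < c + \<eta>")
            case True
            then have "K s q * norm (D q) \<le> K s q * (e / 2)"
              using \<eta>(2)[OF q] K(1)[OF s q] by (intro mult_left_mono) auto
            then show ?thesis using K(1)[OF s q] B by (simp add: mult.commute add_increasing2)
          next
            case False
            then have "s * \<eta> \<le> s * (F q - c)" using s by (intro mult_left_mono) auto
            then have "W q * exp (- s * (F q - c)) \<le> C * exp (- s * \<eta>)"
              using W[OF q] B by (intro mult_mono) auto
            then have "K s q * norm (D q) \<le> (C * exp (- s * \<eta>)) * B"
              unfolding K_def by (rule mult_mono) (use D[OF q] B in auto)
            then show ?thesis using K(1)[OF s q] e by (simp add: mult_ac add_increasing)
          qed
        qed
        show "AE q in M. 0 \<le> e / 2 * K s q + B * C * exp (- s * \<eta>)"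
          using bound by eventually_elim (rule order_trans[OF norm_ge_zero])
      qed
      also have "\<dots> = e / 2 * (\<integral>q. K s q \<partial>M) + b * exp (- s * \<eta>)"
        using intK[OF s] by (simp add: b_def mult_ac)
      finally show ?thesis .
    qed
    have "((\<lambda>s. \<bar>b\<bar> / a * exp ((- (\<eta> / 2)) * s)) \<longlongrightarrow> 0) at_top"
      using \<eta>(1) by (intro tendsto_mult_right_zero filterlim_compose[OF exp_at_bot]
          filterlim_tendsto_neg_mult_at_bot[OF tendsto_const] filterlim_ident) auto
    then have "\<forall>\<^sub>F s in at_top. \<bar>b\<bar> / a * exp ((- (\<eta> / 2)) * s) < e / 2"
      using e by (intro order_tendstoD(2)) auto
    then show "\<forall>\<^sub>F s in at_top. dist ((\<integral>q. K s q *\<^sub>R D q \<partial>M) /\<^sub>R (\<integral>q. K s q \<partial>M)) 0 < e"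
      using eventually_ge_at_top[of 0]
    proof eventually_elim
      case (elim s)
      let ?N = "\<integral>q. K s q \<partial>M"
      let ?x = "exp (- s * (\<eta> / 2))"
      have N: "0 < ?N" using lower[OF elim(2)] a by (smt (verit) exp_gt_zero mult_pos_pos)
      have "exp (- s * \<eta>) = ?x * ?x" by (simp add: exp_add[symmetric])
      then have "\<bar>b\<bar> * exp (- s * \<eta>) = (\<bar>b\<bar> / a * ?x) * (?x * a)" using a by simp
      also have "\<dots> \<le> (\<bar>b\<bar> / a * ?x) * ?N" using lower[OF elim(2)] a by (intro mult_left_mono) auto
      also have "\<dots> < e / 2 * ?N" using elim(1) N by (intro mult_strict_right_mono) (auto simp: mult.commute)
      finally have "\<bar>b\<bar> * exp (- s * \<eta>) < e / 2 * ?N" .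
      moreover have "b * exp (- s * \<eta>) \<le> \<bar>b\<bar> * exp (- s * \<eta>)" by (intro mult_right_mono) auto
      ultimately have "norm (\<integral>q. K s q *\<^sub>R D q \<partial>M) < e * ?N"
        using upper[OF elim(2)] by linarith
      then show ?case using N by (simp add: divide_simps mult.commute)
    qed
  qed
  then show ?thesis unfolding scale .
qed

section \<open>Delzant polytopes and their vertices\<close>

lemma real_vec_nth [simp]: "real_vec k $ i = real_of_int (k $ i)"
  by (simp add: real_vec_def)

lemma real_vec_zero [simp]: "real_vec 0 = 0"
  by (simp add: vec_eq_iff)

lemma real_vec_add: "real_vec (j + k) = real_vec j + real_vec k"
  by (simp add: vec_eq_iff)

lemma real_vec_uminus: "real_vec (- k) = - real_vec k"
  by (simp add: vec_eq_iff)

lemma inner_real_vec: "real_vec j \<bullet> real_vec k = real_of_int (\<Sum>i\<in>UNIV. j $ i * k $ i)"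
  by (simp add: inner_vec_def)

lemma matrix_inv_inverse:
  assumes "invertible A"
  shows "A ** matrix_inv A = mat 1" "matrix_inv A ** A = mat 1"
  using someI_ex[OF assms[unfolded invertible_def]] by (auto simp: matrix_inv_def)

lemma cis_eq_imp:
  assumes "cis a = cis b"
  obtains n :: int where "b = a + 2 * pi * n"
proof -
  have "exp (\<i> * complex_of_real b) = exp (\<i> * complex_of_real a)"
    using assms by (simp add: cis_conv_exp)
  then obtain n :: int where "\<i> * complex_of_real b = \<i> * complex_of_real a + (of_int (2 * n) * pi) * \<i>"
    unfolding exp_eq by blast
  then have "complex_of_real b = complex_of_real (a + 2 * pi * n)"
    by (simp add: algebra_simps complex_eq_iff)
  then show thesis using that of_real_eq_iff by blast
qed

lemma cis_add_int: "cis (a + 2 * pi * real_of_int n) = cis a"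
  using cis_mult[of a "2 * pi * real_of_int n"] by (simp add: cis_multiple_2pi)

lemma ell_diff: "ell r x - ell r y = real_vec (fst r) \<bullet> (x - y)"
  by (simp add: ell_def inner_diff_right)

lemma continuous_on_ell: "continuous_on S (ell r)"
  unfolding ell_def[abs_def] by (intro continuous_intros)

locale delzant_polytope =
  fixes P :: "(real^'n) set"
  assumes delzant: "delzant P"
begin

lemma polytope_P: "polytope P" and interior_nonempty: "interior P \<noteq> {}"
  and finite_facets: "finite (facet_data P)"
  and P_eq: "P = {x. \<forall>r\<in>facet_data P. 0 \<le> ell r x}"
  using delzant unfolding delzant_def by blast+

lemma compact_P: "compact P" and convex_P: "convex P" and closed_P: "closed P"
  using polytope_P by (simp_all add: polytope_imp_compact polytope_imp_convex polytope_imp_closed)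

lemma closure_interior_P: "closure (interior P) = P"
  using convex_closure_interior[OF convex_P interior_nonempty] closed_P by simp

lemma ell_nonneg: "x \<in> P \<Longrightarrow> r \<in> facet_data P \<Longrightarrow> 0 \<le> ell r x"
  using P_eq by blast

lemma facet_face: "r \<in> facet_data P \<Longrightarrow> {x \<in> P. ell r x = 0} face_of P"
  by (simp add: facet_data_def facet_of_imp_face_of)

lemma ell_pos_interior:
  assumes "x \<in> interior P" "r \<in> facet_data P"
  shows "0 < ell r x"
proof -
  have "{x \<in> P. ell r x = 0} \<inter> interior P = {}"
    using assms(2) facet_of_irrefl[of P]
    by (intro face_of_disjoint_interior facet_face) (auto simp: facet_data_def)
  then show ?thesis
    using assms interior_subset ell_nonneg[of x r] by (force simp: less_le)
qed

lemma active_interior: "x \<in> interior P \<Longrightarrow> active P x = {}"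
  using ell_pos_interior by (force simp: active_def)

lemma vertex_mem: "v \<in> vertices P \<Longrightarrow> v \<in> P"
  by (simp add: vertices_def extreme_point_of_def)

lemma vertex_lattice: "v \<in> vertices P \<Longrightarrow> v \<in> lattice"
  using delzant by (simp add: delzant_def)

lemma finite_vertices: "finite (vertices P)"
  unfolding vertices_def by (intro finite_polyhedron_extreme_points polytope_imp_polyhedron polytope_P)

lemma facet_order_bij: "v \<in> vertices P \<Longrightarrow> bij_betw (facet_order P v) UNIV (active P v)"
proof -
  assume "v \<in> vertices P"
  then have "card (UNIV :: 'n set) = card (active P v)"
    using delzant by (simp add: delzant_def)
  moreover have "finite (active P v)"
    using finite_facets by (simp add: active_def)
  ultimately have "\<exists>e. bij_betw e (UNIV :: 'n set) (active P v)"
    by (intro finite_same_card_bij) auto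
  then show ?thesis
    unfolding facet_order_def by (rule someI_ex)
qed

lemma facet_order_active: "v \<in> vertices P \<Longrightarrow> facet_order P v j \<in> active P v"
  using facet_order_bij by (auto simp: bij_betw_def)

lemma active_facet_order: "v \<in> vertices P \<Longrightarrow> r \<in> active P v \<Longrightarrow> \<exists>j. r = facet_order P v j"
  using facet_order_bij by (auto simp: bij_betw_def)

lemma ell_at_nth: "ell_at P v x $ j = ell (facet_order P v j) x"
  by (simp add: ell_at_def normal_matrix_def offset_vec_def ell_def matrix_vector_mul_component)

lemma ell_at_vertex: "v \<in> vertices P \<Longrightarrow> ell_at P v v = 0"
  using facet_order_active[of v] by (simp add: vec_eq_iff ell_at_nth active_def)

lemma ell_at_eq: "v \<in> vertices P \<Longrightarrow> ell_at P v x = normal_matrix P v *v (x - v)"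
  using ell_at_vertex[of v] by (simp add: ell_at_def matrix_vector_mult_diff_distrib)

text \<open>Integer vectors are integer combinations of the normals at a vertex; hence the matrix of
  normals is unimodular.\<close>

lemma lattice_normals:
  assumes "v \<in> vertices P"
  obtains c where "real_vec w = real_vec c v* normal_matrix P v"
proof -
  obtain c where c: "w = (\<Sum>r\<in>active P v. c r *s fst r)"
    using delzant assms unfolding delzant_def by metis
  have "w = (\<Sum>j\<in>UNIV. c (facet_order P v j) *s fst (facet_order P v j))"
    unfolding c by (rule sum.reindex_bij_betw[OF facet_order_bij[OF assms], symmetric])
  then have "real_vec w = real_vec (\<chi> j. c (facet_order P v j)) v* normal_matrix P v"
    by (simp add: vec_eq_iff vector_matrix_mult_def normal_matrix_def mult.commute)
  then show thesis by (rule that)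
qed

lemma invertible_normal_matrix:
  assumes "v \<in> vertices P"
  shows "invertible (normal_matrix P v)"
proof -
  let ?A = "normal_matrix P v"
  have "\<exists>c. axis i (1::real) = c v* ?A" for i
  proof -
    have "axis i (1::real) = real_vec (axis i 1)" by (simp add: vec_eq_iff axis_def)
    then show ?thesis using lattice_normals[OF assms] by metis
  qed
  then obtain c where c: "\<And>i. axis i (1::real) = c i v* ?A" by metis
  have "surj (\<lambda>x. transpose ?A *v x)"
  proof (rule surjI[where f = "\<lambda>y. \<Sum>i\<in>UNIV. (y $ i) *\<^sub>R c i"])
    fix y :: "real^'n"
    have "transpose ?A *v (\<Sum>i\<in>UNIV. (y $ i) *\<^sub>R c i) = (\<Sum>i\<in>UNIV. (y $ i) *\<^sub>R (transpose ?A *v c i))"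
      by (simp only: linear_sum[OF matrix_vector_mul_linear] linear_scale[OF matrix_vector_mul_linear])
    also have "\<dots> = y"
      using basis_expansion[of y] by (simp add: c[symmetric] scalar_mult_eq_scaleR)
    finally show "transpose ?A *v (\<Sum>i\<in>UNIV. (y $ i) *\<^sub>R c i) = y" .
  qed
  then have "\<exists>B. transpose ?A ** B = mat 1"
    unfolding matrix_right_invertible_surjective .
  then show ?thesis
    by (simp add: right_invertible_transpose invertible_left_inverse)
qed

lemma vartheta_eq: "vartheta P v \<theta> = \<theta> v* matrix_inv (normal_matrix P v)"
  by (simp add: vartheta_def)

lemma vartheta_normal_matrix: "v \<in> vertices P \<Longrightarrow> vartheta P v (u v* normal_matrix P v) = u"
  using matrix_inv_inverse(1)[OF invertible_normal_matrix]
  by (simp add: vartheta_eq vector_matrix_mul_assoc)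

lemma normal_matrix_vartheta: "v \<in> vertices P \<Longrightarrow> vartheta P v \<theta> v* normal_matrix P v = \<theta>"
  using matrix_inv_inverse(2)[OF invertible_normal_matrix]
  by (simp add: vartheta_eq vector_matrix_mul_assoc)

lemma linear_vartheta: "linear (vartheta P v)"
  unfolding vartheta_def[abs_def] by (rule matrix_vector_mul_linear)

lemma vartheta_real_vec: "v \<in> vertices P \<Longrightarrow> \<exists>c. vartheta P v (real_vec w) = real_vec c"
  by (metis lattice_normals vartheta_normal_matrix)

lemma real_vec_normal_matrix: "\<exists>c. real_vec w v* normal_matrix P v = real_vec c"
proof
  show "real_vec w v* normal_matrix P v = real_vec (\<chi> i. \<Sum>j\<in>UNIV. fst (facet_order P v j) $ i * w $ j)"
    by (simp add: vec_eq_iff vector_matrix_mult_def normal_matrix_def mult.commute)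
qed

lemma axis_normal_matrix: "axis j 1 v* normal_matrix P v = real_vec (fst (facet_order P v j))"
  by (simp add: vec_eq_iff vector_matrix_mult_def normal_matrix_def axis_def if_distrib if_distribR cong: if_cong)

lemma vartheta_normal: "v \<in> vertices P \<Longrightarrow> vartheta P v (real_vec (fst (facet_order P v j))) = axis j 1"
  by (metis axis_normal_matrix vartheta_normal_matrix)

text \<open>Although it is written with the chart at \<open>v\<close>, the phase of a monomial section depends on
  that chart only through the translation by \<open>v\<close>.\<close>

lemma ell_at_inner_vartheta:
  assumes "v \<in> vertices P"
  shows "ell_at P v m \<bullet> vartheta P v \<theta> = (m - v) \<bullet> \<theta>"
proof -
  have "vartheta P v \<theta> \<bullet> (normal_matrix P v *v (m - v)) = (vartheta P v \<theta> v* normal_matrix P v) \<bullet> (m - v)"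
    by (simp add: dot_lmul_matrix)
  then show ?thesis
    using assms by (simp add: ell_at_eq normal_matrix_vartheta inner_commute)
qed

lemma face_of_active: 
  assumes "R \<subseteq> facet_data P"
  shows "{y \<in> P. \<forall>r\<in>R. ell r y = 0} face_of P"
proof -
  have "\<Inter> (insert P ((\<lambda>r. {y \<in> P. ell r y = 0}) ` R)) face_of P"
    using assms facet_face face_of_refl[OF convex_P] by (intro face_of_Inter) auto
  moreover have "\<Inter> (insert P ((\<lambda>r. {y \<in> P. ell r y = 0}) ` R)) = {y \<in> P. \<forall>r\<in>R. ell r y = 0}"
    by auto
  ultimately show ?thesis by simp
qed

text \<open>A facet that meets the relative interior of a face contains the whole face, in particular its
  vertex \<open>v\<close>. Conversely \<open>x\<close> is relatively interior to the face cut out by the facets through \<open>x\<close>,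
  because the other facet functions stay positive nearby.\<close>

lemma vertex_star_iff:
  assumes v: "v \<in> vertices P"
  shows "x \<in> vertex_star P v \<longleftrightarrow> x \<in> P \<and> active P x \<subseteq> active P v"
proof
  assume "x \<in> vertex_star P v"
  then obtain F where F: "F face_of P" "v \<in> F" "x \<in> rel_interior F"
    by (auto simp: vertex_star_def)
  have FP: "F \<subseteq> P" "x \<in> F" using F face_of_imp_subset rel_interior_subset by blast+
  have "r \<in> active P v" if r: "r \<in> active P x" for r
  proof -
    have rf: "r \<in> facet_data P" "ell r x = 0" using r by (auto simp: active_def)
    have "F \<subseteq> {y \<in> P. ell r y = 0}"
      using FP F(3) rf by (intro subset_of_face_of[OF facet_face]) auto
    then show ?thesis using F(2) rf by (auto simp: active_def)
  qed
  then show "x \<in> P \<and> active P x \<subseteq> active P v" using FP by auto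
next
  assume x: "x \<in> P \<and> active P x \<subseteq> active P v"
  define F where "F = {y \<in> P. \<forall>r\<in>active P x. ell r y = 0}"
  have F: "F face_of P" unfolding F_def by (rule face_of_active) (auto simp: active_def)
  have vF: "v \<in> F" using x v vertex_mem by (auto simp: F_def active_def)
  let ?T = "\<Inter>r\<in>facet_data P - active P x. {y. 0 < ell r y}"
  have oT: "open ?T"
    using finite_facets by (intro open_INT ballI open_Collect_less continuous_on_const continuous_on_ell) auto
  have xT: "x \<in> ?T \<inter> F"
    using x ell_nonneg by (auto simp: F_def active_def less_le)
  have "?T \<inter> affine hull F \<subseteq> F"
  proof
    fix y assume y: "y \<in> ?T \<inter> affine hull F"
    have "affine hull F \<subseteq> {y. \<forall>r\<in>active P x. ell r y = 0}"
    proof (rule hull_minimal)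
      show "affine {y. \<forall>r\<in>active P x. ell r y = 0}"
      proof -
        have "{y. \<forall>r\<in>active P x. ell r y = 0} =
          \<Inter> ((\<lambda>r. {y. real_vec (fst r) \<bullet> y = real_of_int (snd r)}) ` active P x)"
          by (auto simp: ell_def)
        then show ?thesis by (auto intro!: affine_Inter affine_hyperplane)
      qed
    qed (auto simp: F_def)
    then have a: "\<forall>r\<in>active P x. ell r y = 0" using y by auto
    have "0 \<le> ell r y" if "r \<in> facet_data P" for r
    proof (cases "r \<in> active P x")
      case False
      then have "0 < ell r y" using y that by blast
      then show ?thesis by simp
    qed (use a in simp)
    then have "y \<in> P" using P_eq by blast
    then show "y \<in> F" using a by (simp add: F_def)
  qed
  then have "x \<in> rel_interior F"
    using oT xT by (auto simp: mem_rel_interior)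
  then show "x \<in> vertex_star P v"
    using F vF by (auto simp: vertex_star_def)
qed

text \<open>The face cut out by the facets through \<open>x\<close> is compact and convex and hence has an extreme
  point, which is a vertex of \<open>P\<close>.\<close>

lemma exists_vertex:
  assumes "x \<in> P"
  obtains v where "v \<in> vertices P" "x \<in> vertex_star P v"
proof -
  let ?F = "{y \<in> P. \<forall>r\<in>active P x. ell r y = 0}"
  have F: "?F face_of P" by (rule face_of_active) (auto simp: active_def)
  have "compact ?F" "convex ?F"
    using F compact_P convex_P by (auto intro: face_of_imp_compact face_of_imp_convex)
  then have "?F = convex hull {v. v extreme_point_of ?F}" by (rule Krein_Milman_Minkowski)
  moreover have "x \<in> ?F" using assms by (auto simp: active_def)
  ultimately obtain v where "v extreme_point_of ?F"
    by (metis (no_types, lifting) Collect_empty_eq convex_hull_empty empty_iff)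
  then have v: "v \<in> vertices P" "v \<in> ?F"
    using extreme_point_of_face[OF F] by (auto simp: vertices_def)
  have "x \<in> vertex_star P v"
    using assms v by (subst vertex_star_iff) (auto simp: active_def)
  then show thesis using v(1) that by blast
qed

lemma interior_subset_vertex_star: "v \<in> vertices P \<Longrightarrow> x \<in> interior P \<Longrightarrow> x \<in> vertex_star P v"
  using interior_subset by (auto simp: vertex_star_iff active_interior)

lemma vertex_star_subset: "v \<in> vertices P \<Longrightarrow> x \<in> vertex_star P v \<Longrightarrow> x \<in> P"
  by (simp add: vertex_star_iff)

section \<open>Points of the toric manifold and the vertex charts\<close>

text \<open>The points of the manifold are equivalence classes, and \<^const>\<open>angles\<close> chooses a
  representative. Everything below is first computed for arbitrary representatives \<open>(x, \<theta>)\<close>; the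
  relation on the angles over \<open>x\<close> then takes care of the choice.\<close>

definition angle_rel :: "real^'n \<Rightarrow> real^'n \<Rightarrow> real^'n \<Rightarrow> bool" where
  "angle_rel x \<theta> \<theta>' \<longleftrightarrow>
     (\<exists>k. \<theta>' - \<theta> - (2 * pi) *\<^sub>R real_vec k \<in> span ((real_vec \<circ> fst) ` active P x))"

lemma angle_rel_refl: "angle_rel x \<theta> \<theta>"
  unfolding angle_rel_def by (rule exI[of _ 0]) (simp add: span_zero)

lemma angle_rel_sym: "angle_rel x \<theta> \<theta>' \<Longrightarrow> angle_rel x \<theta>' \<theta>"
proof -
  assume "angle_rel x \<theta> \<theta>'"
  then obtain k where "\<theta>' - \<theta> - (2 * pi) *\<^sub>R real_vec k \<in> span ((real_vec \<circ> fst) ` active P x)"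
    by (auto simp: angle_rel_def)
  from span_neg[OF this] show ?thesis
    unfolding angle_rel_def by (intro exI[of _ "- k"]) (simp add: real_vec_uminus algebra_simps)
qed

lemma angle_rel_trans: "angle_rel x \<theta> \<theta>' \<Longrightarrow> angle_rel x \<theta>' \<theta>'' \<Longrightarrow> angle_rel x \<theta> \<theta>''"
proof -
  assume "angle_rel x \<theta> \<theta>'" "angle_rel x \<theta>' \<theta>''"
  then obtain k l where "\<theta>' - \<theta> - (2 * pi) *\<^sub>R real_vec k \<in> span ((real_vec \<circ> fst) ` active P x)"
    "\<theta>'' - \<theta>' - (2 * pi) *\<^sub>R real_vec l \<in> span ((real_vec \<circ> fst) ` active P x)"
    by (auto simp: angle_rel_def)
  from span_add[OF this] show ?thesis
    unfolding angle_rel_def by (intro exI[of _ "k + l"]) (simp add: real_vec_add algebra_simps)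
qed

lemma mem_pt_iff: "(x', \<theta>') \<in> pt P x \<theta> \<longleftrightarrow> x \<in> P \<and> x' = x \<and> angle_rel x \<theta> \<theta>'"
  by (simp add: pt_def toric_rel_def angle_rel_def)

lemma pt_eqI: "angle_rel x \<theta> \<theta>' \<Longrightarrow> pt P x \<theta> = pt P x \<theta>'"
  by (auto simp: mem_pt_iff) (blast intro: angle_rel_sym angle_rel_trans)+

lemma toric_mfd_iff: "p \<in> toric_mfd P \<longleftrightarrow> (\<exists>x\<in>P. \<exists>\<theta>. p = pt P x \<theta>)"
  by (auto simp: toric_mfd_def quotient_def pt_def)

lemma pt_some:
  assumes "x \<in> P"
  shows "(SOME q. q \<in> pt P x \<theta>) \<in> pt P x \<theta>"
  by (rule someI[where x = "(x, \<theta>)"]) (simp add: mem_pt_iff assms angle_rel_refl)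

lemma moment_pt: "x \<in> P \<Longrightarrow> moment (pt P x \<theta>) = x"
  using pt_some[of x \<theta>] by (cases "SOME q. q \<in> pt P x \<theta>") (simp add: moment_def mem_pt_iff)

lemma angles_pt: "x \<in> P \<Longrightarrow> angle_rel x \<theta> (angles (pt P x \<theta>))"
  using pt_some[of x \<theta>] by (cases "SOME q. q \<in> pt P x \<theta>") (simp add: angles_def mem_pt_iff)

lemma pt_moment_angles: "p \<in> toric_mfd P \<Longrightarrow> pt P (moment p) (angles p) = p"
  using pt_eqI[OF angles_pt] by (auto simp only: toric_mfd_iff moment_pt)

lemma pt_chart_dom_iff:
  "v \<in> vertices P \<Longrightarrow> pt P x \<theta> \<in> chart_dom P v \<longleftrightarrow> x \<in> vertex_star P v" if "x \<in> P"
  using that by (auto simp: chart_dom_def moment_pt toric_mfd_iff)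

lemma chart_dom_mfd: "p \<in> chart_dom P v \<Longrightarrow> p \<in> toric_mfd P"
  by (simp add: chart_dom_def)

lemma chart_dom_moment: "p \<in> chart_dom P v \<Longrightarrow> moment p \<in> vertex_star P v"
  by (simp add: chart_dom_def)

text \<open>At the vertex \<open>v\<close> the ambiguity of the angles becomes the usual one of polar coordinates:
  multiples of \<open>2\<pi>\<close>, and anything where the radius vanishes.\<close>

lemma angle_rel_vartheta:
  assumes v: "v \<in> vertices P" and x: "x \<in> vertex_star P v"
  shows "angle_rel x \<theta> \<theta>' \<longleftrightarrow> (\<exists>c u. vartheta P v \<theta>' = vartheta P v \<theta> + (2 * pi) *\<^sub>R real_vec c + u \<and>
           (\<forall>j. facet_order P v j \<notin> active P x \<longrightarrow> u $ j = 0))"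
proof
  have ax: "active P x \<subseteq> active P v" using assms by (simp add: vertex_star_iff)
  assume "angle_rel x \<theta> \<theta>'"
  then obtain k where k: "\<theta>' - \<theta> - (2 * pi) *\<^sub>R real_vec k \<in> span ((real_vec \<circ> fst) ` active P x)"
    by (auto simp: angle_rel_def)
  let ?S = "{y. \<forall>j. facet_order P v j \<notin> active P x \<longrightarrow> vartheta P v y $ j = 0}"
  have "span ((real_vec \<circ> fst) ` active P x) \<subseteq> ?S"
  proof (rule span_minimal)
    show "(real_vec \<circ> fst) ` active P x \<subseteq> ?S"
    proof clarsimp
      fix a b j assume r: "(a, b) \<in> active P x" and j: "facet_order P v j \<notin> active P x"
      obtain i where i: "(a, b) = facet_order P v i" using r ax active_facet_order[OF v] by blast
      then have "i \<noteq> j" using r j by auto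
      then show "vartheta P v (real_vec a) $ j = 0"
        using vartheta_normal[OF v, of i] i[symmetric] by (simp add: axis_def)
    qed
    show "subspace ?S"
      by (auto simp: subspace_def linear_0[OF linear_vartheta] linear_add[OF linear_vartheta]
          linear_scale[OF linear_vartheta])
  qed
  with k have u: "\<theta>' - \<theta> - (2 * pi) *\<^sub>R real_vec k \<in> ?S" by blast
  obtain c where c: "vartheta P v (real_vec k) = real_vec c" using vartheta_real_vec[OF v] by blast
  have "vartheta P v \<theta>' = vartheta P v \<theta> + (2 * pi) *\<^sub>R real_vec c + vartheta P v (\<theta>' - \<theta> - (2 * pi) *\<^sub>R real_vec k)"
    by (simp add: linear_diff[OF linear_vartheta] linear_scale[OF linear_vartheta] c)
  then show "\<exists>c u. vartheta P v \<theta>' = vartheta P v \<theta> + (2 * pi) *\<^sub>R real_vec c + u \<and>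
           (\<forall>j. facet_order P v j \<notin> active P x \<longrightarrow> u $ j = 0)"
    using u by blast
next
  assume "\<exists>c u. vartheta P v \<theta>' = vartheta P v \<theta> + (2 * pi) *\<^sub>R real_vec c + u \<and>
           (\<forall>j. facet_order P v j \<notin> active P x \<longrightarrow> u $ j = 0)"
  then obtain c u where cu: "vartheta P v \<theta>' = vartheta P v \<theta> + (2 * pi) *\<^sub>R real_vec c + u"
    "\<And>j. facet_order P v j \<notin> active P x \<Longrightarrow> u $ j = 0" by blast
  let ?A = "normal_matrix P v"
  obtain k where k: "real_vec c v* ?A = real_vec k" using real_vec_normal_matrix by blast
  have "\<theta>' = (vartheta P v \<theta> + (2 * pi) *\<^sub>R real_vec c + u) v* ?A"
    using normal_matrix_vartheta[OF v, of \<theta>'] cu(1) by simp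
  also have "\<dots> = \<theta> + (2 * pi) *\<^sub>R real_vec k + u v* ?A"
    using normal_matrix_vartheta[OF v, of \<theta>] k
    by (simp add: vector_matrix_left_distrib scaleR_vector_matrix_assoc)
  finally have eq: "\<theta>' - \<theta> - (2 * pi) *\<^sub>R real_vec k = u v* ?A" by simp
  have "u v* ?A = (\<Sum>j\<in>UNIV. (u $ j) *\<^sub>R real_vec (fst (facet_order P v j)))"
    by (simp add: vec_eq_iff vector_matrix_mult_def normal_matrix_def mult.commute)
  also have "\<dots> \<in> span ((real_vec \<circ> fst) ` active P x)"
  proof (rule span_sum)
    fix j
    show "(u $ j) *\<^sub>R real_vec (fst (facet_order P v j)) \<in> span ((real_vec \<circ> fst) ` active P x)"
    proof (cases "facet_order P v j \<in> active P x")
      case True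
      then have "(real_vec \<circ> fst) (facet_order P v j) \<in> (real_vec \<circ> fst) ` active P x" by (rule imageI)
      from span_scale[OF span_base[OF this], of "u $ j"] show ?thesis by (simp only: comp_def)
    qed (simp add: cu(2) span_zero)
  qed
  finally show "angle_rel x \<theta> \<theta>'"
    unfolding angle_rel_def eq[symmetric] by blast
qed

text \<open>The chart at \<open>v\<close> as a function of a representative \<open>(x, \<theta>)\<close>; unlike \<^const>\<open>chart\<close> it is
  visibly continuous, also in \<open>x\<close> up to the facets through \<open>v\<close>.\<close>

definition polar :: "real^'n \<Rightarrow> real^'n \<Rightarrow> real^'n \<Rightarrow> complex^'n" where
  "polar v x \<theta> = (\<chi> j. complex_of_real (sqrt (2 * ell_at P v x $ j)) * cis (vartheta P v \<theta> $ j))"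

lemma chart_eq_polar: "chart P v p = polar v (moment p) (angles p)"
  by (simp add: chart_def polar_def)

lemma ell_at_nonneg: "v \<in> vertices P \<Longrightarrow> x \<in> P \<Longrightarrow> 0 \<le> ell_at P v x $ j"
  using facet_order_active[of v j] ell_nonneg by (simp add: ell_at_nth active_def)

lemma ell_at_zero_iff: "v \<in> vertices P \<Longrightarrow> ell_at P v x $ j = 0 \<longleftrightarrow> facet_order P v j \<in> active P x"
  using facet_order_active[of v j] by (simp add: ell_at_nth active_def)

lemma polar_cong:
  assumes "v \<in> vertices P" "x \<in> vertex_star P v" "angle_rel x \<theta> \<theta>'"
  shows "polar v x \<theta> = polar v x \<theta>'"
proof -
  obtain c u where cu: "vartheta P v \<theta>' = vartheta P v \<theta> + (2 * pi) *\<^sub>R real_vec c + u"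
    "\<And>j. facet_order P v j \<notin> active P x \<Longrightarrow> u $ j = 0"
    using assms angle_rel_vartheta by blast
  show ?thesis
    using cu(2) ell_at_zero_iff[OF assms(1)] by (force simp: polar_def vec_eq_iff cu(1) cis_add_int)
qed

text \<open>The moment map in the chart at \<open>v\<close>: the equations \<open>l\<^sub>j = |z\<^sub>j|^2 / 2\<close> solved for \<open>x\<close>. It is
  defined by the same formula on all of the coordinate space.\<close>

definition moment_of :: "real^'n \<Rightarrow> complex^'n \<Rightarrow> real^'n" where
  "moment_of v z = matrix_inv (normal_matrix P v) *v ((\<chi> j. (cmod (z $ j))\<^sup>2 / 2) + offset_vec P v)"

lemma ell_at_moment_of: "v \<in> vertices P \<Longrightarrow> ell_at P v (moment_of v z) $ j = (cmod (z $ j))\<^sup>2 / 2"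
  by (simp add: ell_at_def moment_of_def matrix_vector_mul_assoc matrix_inv_inverse invertible_normal_matrix)

lemma ell_at_inj: "v \<in> vertices P \<Longrightarrow> ell_at P v x = ell_at P v y \<Longrightarrow> x = y"
proof -
  assume v: "v \<in> vertices P" and "ell_at P v x = ell_at P v y"
  then have "matrix_inv (normal_matrix P v) *v (normal_matrix P v *v x) =
      matrix_inv (normal_matrix P v) *v (normal_matrix P v *v y)"
    by (simp add: ell_at_def)
  then show "x = y"
    by (simp add: matrix_vector_mul_assoc matrix_inv_inverse invertible_normal_matrix v)
qed

lemma cmod_polar: "v \<in> vertices P \<Longrightarrow> x \<in> P \<Longrightarrow> (cmod (polar v x \<theta> $ j))\<^sup>2 / 2 = ell_at P v x $ j"
  by (simp add: polar_def norm_mult ell_at_nonneg)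

lemma moment_of_polar: "v \<in> vertices P \<Longrightarrow> x \<in> P \<Longrightarrow> moment_of v (polar v x \<theta>) = x"
  by (rule ell_at_inj[of v]) (simp_all add: vec_eq_iff ell_at_moment_of cmod_polar)

text \<open>The moduli of the coordinates determine \<open>x\<close>, and the arguments determine \<open>\<theta>\<close> up to \<open>2\<pi>\<close>
  except where the coordinate vanishes, which is exactly the ambiguity allowed over \<open>x\<close>.\<close>

lemma polar_inj:
  assumes v: "v \<in> vertices P" and x: "x \<in> vertex_star P v" "x' \<in> vertex_star P v"
    and eq: "polar v x \<theta> = polar v x' \<theta>'"
  shows "x = x' \<and> angle_rel x \<theta> \<theta>'"
proof
  show xx: "x = x'" using moment_of_polar[OF v] x vertex_star_subset[OF v] eq by metis
  have "\<exists>n u. vartheta P v \<theta>' $ j = vartheta P v \<theta> $ j + 2 * pi * real_of_int n + u \<and>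
      (facet_order P v j \<notin> active P x \<longrightarrow> u = 0)" for j
  proof (cases "facet_order P v j \<in> active P x")
    case True
    then show ?thesis
      by (intro exI[of _ 0] exI[of _ "vartheta P v \<theta>' $ j - vartheta P v \<theta> $ j"]) simp
  next
    case False
    then have "ell_at P v x $ j \<noteq> 0" using ell_at_zero_iff[OF v] by blast
    moreover have "polar v x \<theta> $ j = polar v x \<theta>' $ j" using eq xx by simp
    ultimately have "cis (vartheta P v \<theta> $ j) = cis (vartheta P v \<theta>' $ j)"
      by (simp add: polar_def)
    then obtain n :: int where "vartheta P v \<theta>' $ j = vartheta P v \<theta> $ j + 2 * pi * n" by (rule cis_eq_imp)
    then show ?thesis by (intro exI[of _ n] exI[of _ 0]) simp
  qed
  then obtain n u where nu: "\<And>j. vartheta P v \<theta>' $ j = vartheta P v \<theta> $ j + 2 * pi * real_of_int (n j) + u j"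
    "\<And>j. facet_order P v j \<notin> active P x \<Longrightarrow> u j = 0" by metis
  show "angle_rel x \<theta> \<theta>'"
    unfolding angle_rel_vartheta[OF v x(1)]
    by (rule exI[of _ "\<chi> j. n j"], rule exI[of _ "\<chi> j. u j"]) (simp add: vec_eq_iff nu)
qed

lemma chart_pt:
  assumes "v \<in> vertices P" "x \<in> vertex_star P v"
  shows "chart P v (pt P x \<theta>) = polar v x \<theta>"
  using vertex_star_subset[OF assms]
  by (simp add: chart_eq_polar moment_pt polar_cong[OF assms angles_pt, symmetric])

lemma inj_on_chart: "v \<in> vertices P \<Longrightarrow> inj_on (chart P v) (chart_dom P v)"
  by (rule inj_onI) (metis chart_dom_mfd chart_dom_moment chart_eq_polar polar_inj pt_eqI pt_moment_angles)

lemma in_chart_polar: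
  assumes "v \<in> vertices P" "x \<in> vertex_star P v"
  shows "in_chart P v f (polar v x \<theta>) = f (pt P x \<theta>)"
proof -
  have "pt P x \<theta> \<in> chart_dom P v"
    using assms vertex_star_subset by (simp add: pt_chart_dom_iff)
  then have "inv_into (chart_dom P v) (chart P v) (chart P v (pt P x \<theta>)) = pt P x \<theta>"
    using assms(1) by (intro inv_into_f_f inj_on_chart)
  then show ?thesis by (simp add: in_chart_def chart_pt[OF assms])
qed

lemma polar_in_image:
  assumes "v \<in> vertices P" "x \<in> vertex_star P v"
  shows "polar v x \<theta> \<in> chart P v ` chart_dom P v"
  using assms vertex_star_subset by (metis chart_pt imageI pt_chart_dom_iff)

text \<open>The facets through \<open>v\<close> impose no condition, since their functions are \<open>|z\<^sub>j|^2 / 2\<close>; only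
  the strict inequalities for the remaining facets are left, which makes the image open.\<close>

lemma chart_image_eq:
  assumes v: "v \<in> vertices P"
  shows "chart P v ` chart_dom P v = {z. \<forall>r\<in>facet_data P - active P v. 0 < ell r (moment_of v z)}"
proof (intro equalityI subsetI)
  fix z assume "z \<in> chart P v ` chart_dom P v"
  then obtain p where p: "p \<in> chart_dom P v" "z = polar v (moment p) (angles p)"
    by (auto simp: chart_eq_polar)
  then have m: "moment p \<in> P" "active P (moment p) \<subseteq> active P v"
    using chart_dom_moment[OF p(1)] by (auto simp: vertex_star_iff[OF v])
  have "0 < ell r (moment p)" if "r \<in> facet_data P - active P v" for r
    using that m ell_nonneg[OF m(1), of r] by (auto simp: active_def less_le)
  then show "z \<in> {z. \<forall>r\<in>facet_data P - active P v. 0 < ell r (moment_of v z)}"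
    by (simp add: p(2) moment_of_polar[OF v m(1)])
next
  fix z assume z: "z \<in> {z. \<forall>r\<in>facet_data P - active P v. 0 < ell r (moment_of v z)}"
  define x where "x = moment_of v z"
  have "0 \<le> ell r x" if "r \<in> facet_data P" for r
  proof (cases "r \<in> active P v")
    case True
    then obtain j where "r = facet_order P v j" using active_facet_order[OF v] by blast
    then have "ell r x = (cmod (z $ j))\<^sup>2 / 2" using ell_at_moment_of[OF v, of z j] by (simp add: x_def ell_at_nth)
    then show ?thesis by (simp only: zero_le_power2 zero_le_divide_iff) simp
  next
    case False
    then have "0 < ell r x" using z that by (simp add: x_def)
    then show ?thesis by simp
  qed
  then have "x \<in> P" using P_eq by blast
  moreover have "active P x \<subseteq> active P v" using z by (force simp: active_def x_def)
  ultimately have x: "x \<in> vertex_star P v" by (simp add: vertex_star_iff[OF v])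
  have "polar v x ((\<chi> j. Arg (z $ j)) v* normal_matrix P v) = z"
    using rcis_cmod_Arg by (simp add: polar_def vartheta_normal_matrix[OF v] x_def ell_at_moment_of[OF v] vec_eq_iff rcis_def)
  then show "z \<in> chart P v ` chart_dom P v" using polar_in_image[OF v x] by metis
qed

lemma continuous_on_moment_of: "continuous_on S (moment_of v)"
proof -
  have "continuous_on S (\<lambda>z. (\<chi> j. (cmod (z $ j))\<^sup>2 / 2) + offset_vec P v)"
    by (intro continuous_intros) simp_all
  then show ?thesis
    unfolding moment_of_def[abs_def]
    by (rule continuous_on_compose2[OF matrix_vector_mult_linear_continuous_on[where S = UNIV]]) simp
qed

lemma smooth_on_moment_of: "open S \<Longrightarrow> smooth_on S (moment_of v)"
proof -
  assume S: "open S"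
  have "smooth_on S (\<lambda>z::complex^'n. ((\<chi> j. (cmod (z $ j))\<^sup>2 / 2) + offset_vec P v) $ i)" for i
  proof -
    have "smooth_on S (\<lambda>z::complex^'n. (1/2) * (z $ i \<bullet> z $ i) + offset_vec P v $ i)"
      by (intro smooth_on_add S smooth_on_const smooth_on_linear_image[OF bounded_linear_mult_right]
          smooth_on_bilinear[OF bounded_bilinear_inner] smooth_on_linear bounded_linear_vec_nth)
    then show ?thesis by (simp add: power2_norm_eq_inner)
  qed
  from smooth_on_linear_image[OF matrix_vector_mul_bounded_linear S smooth_on_vec[OF S this]]
  show ?thesis unfolding moment_of_def[abs_def] .
qed

lemma moment_of_image: "v \<in> vertices P \<Longrightarrow> z \<in> chart P v ` chart_dom P v \<Longrightarrow> moment_of v z \<in> P"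
  using chart_dom_moment vertex_star_subset by (force simp: chart_eq_polar moment_of_polar)

lemma open_chart_image:
  assumes "v \<in> vertices P"
  shows "open (chart P v ` chart_dom P v)"
proof -
  have "chart P v ` chart_dom P v = (\<Inter>r\<in>facet_data P - active P v. {z. 0 < ell r (moment_of v z)})"
    using chart_image_eq[OF assms] by auto
  moreover have "continuous_on UNIV (\<lambda>z. ell r (moment_of v z))" for r
    by (rule continuous_on_compose2[OF continuous_on_ell[where S = UNIV] continuous_on_moment_of]) simp
  ultimately show ?thesis
    using finite_facets by (auto intro!: open_INT open_Collect_less continuous_on_const)
qed

lemma continuous_on_polar: "continuous_on S (\<lambda>(x, \<theta>). polar v x \<theta>)"
proof -
  have 1: "continuous_on S (\<lambda>q. ell_at P v (fst q))"
    unfolding ell_at_def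
    by (intro continuous_intros continuous_on_compose2[OF matrix_vector_mult_linear_continuous_on[where S = UNIV]]) auto
  have 2: "continuous_on S (\<lambda>q. vartheta P v (snd q))"
    unfolding vartheta_def
    by (intro continuous_intros continuous_on_compose2[OF matrix_vector_mult_linear_continuous_on[where S = UNIV]]) auto
  have 3: "continuous_on S (\<lambda>q. cis (vartheta P v (snd q) $ j))" for j
    by (rule continuous_on_compose2[of UNIV cis]) (auto intro!: continuous_intros 2)
  show ?thesis
    unfolding polar_def case_prod_beta
    by (intro continuous_on_vec_lambda continuous_on_mult 3 continuous_intros 1)
qed

end

section \<open>Integration over the toric manifold\<close>

lemma torus_cell_measure: "0 < measure lborel (torus_cell :: (real^'n) set)"
proof -
  have "0 < (\<Prod>b\<in>Basis. ((\<chi> i. 2 * pi) - (0 :: real^'n)) \<bullet> b)"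
    by (intro prod_pos) (auto simp: Basis_vec_def inner_axis)
  moreover have "\<forall>b\<in>Basis. (0 :: real^'n) \<bullet> b \<le> (\<chi> i. 2 * pi) \<bullet> b"
    by (auto simp: Basis_vec_def inner_axis)
  ultimately show ?thesis
    unfolding torus_cell_def measure_lborel_cbox_eq by simp
qed

lemma compact_torus_cell: "compact (torus_cell :: (real^'n) set)"
  by (simp add: torus_cell_def)

lemma torus_cell_sets [measurable]: "torus_cell \<in> sets borel"
  by (simp add: torus_cell_def)

lemma emeasure_torus_cell: "emeasure lborel (torus_cell :: (real^'n) set) = ennreal (measure lborel (torus_cell :: (real^'n) set))"
  unfolding torus_cell_def
  by (intro emeasure_eq_ennreal_measure) (metis emeasure_lborel_cbox_finite infinity_ennreal_def less_irrefl)

lemma integral_uniform_torus: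
  fixes f :: "real^'n \<Rightarrow> complex"
  assumes [measurable]: "f \<in> borel_measurable borel"
  shows "integral\<^sup>L (uniform_measure lborel torus_cell) f =
    (\<integral>\<theta>. indicator torus_cell \<theta> *\<^sub>R f \<theta> \<partial>lborel) /\<^sub>R measure lborel (torus_cell :: (real^'n) set)"
proof -
  let ?c = "measure lborel (torus_cell :: (real^'n) set)"
  have "uniform_measure lborel (torus_cell :: (real^'n) set) = density lborel (\<lambda>\<theta>. ennreal (indicator torus_cell \<theta> / ?c))"
    unfolding uniform_measure_def emeasure_torus_cell
    using divide_ennreal[of 1 ?c] torus_cell_measure
    by (intro arg_cong[where f = "density lborel"] ext) (auto simp: indicator_def)
  then have "integral\<^sup>L (uniform_measure lborel torus_cell) f = (\<integral>\<theta>. (indicator torus_cell \<theta> / ?c) *\<^sub>R f \<theta> \<partial>lborel)"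
    by (simp add: integral_density)
  also have "\<dots> = (\<integral>\<theta>. (indicator torus_cell \<theta> *\<^sub>R f \<theta>) /\<^sub>R ?c \<partial>lborel)"
    by (intro Bochner_Integration.integral_cong) (simp_all add: divide_inverse mult.commute)
  finally show ?thesis by (simp only: integral_scaleR_right)
qed

context delzant_polytope
begin

text \<open>The Liouville measure lives on representatives \<open>(x, \<theta>)\<close> over the interior of \<open>P\<close>; as a finite
  measure in its own right it can be fed to the concentration principle.\<close>

definition liouville_measure :: "((real^'n) \<times> (real^'n)) measure" where
  "liouville_measure = restrict_space lborel (interior P \<times> torus_cell)"

lemma sets_Times [measurable]: "interior P \<times> torus_cell \<in> sets (borel :: ((real^'n) \<times> (real^'n)) measure)"
  by (intro borel_Times) auto

lemma space_liouville_measure: "space liouville_measure = interior P \<times> torus_cell"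
  by (simp add: liouville_measure_def space_restrict_space)

lemma finite_liouville_measure: "finite_measure liouville_measure"
proof
  have "bounded (interior P \<times> torus_cell)"
    using bounded_Times[OF bounded_interior[OF compact_imp_bounded[OF compact_P]] compact_imp_bounded[OF compact_torus_cell]] .
  then have "emeasure lborel (interior P \<times> torus_cell) < \<infinity>" by (rule emeasure_bounded_finite)
  then show "emeasure liouville_measure (space liouville_measure) \<noteq> \<infinity>"
    unfolding space_liouville_measure by (simp add: liouville_measure_def emeasure_restrict_space less_top[symmetric])
qed

text \<open>Integrands are known to be continuous only on the open orbit, so measurability is asked
  relative to it.\<close>

lemma continuous_imp_measurable:
  fixes f :: "(real^'n) \<times> (real^'n) \<Rightarrow> 'b::topological_space"
  assumes "continuous_on (interior P \<times> torus_cell) f"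
  shows "f \<in> borel_measurable liouville_measure"
proof -
  have "f \<in> borel_measurable (restrict_space borel (interior P \<times> torus_cell))"
    by (rule borel_measurable_continuous_on_restrict[OF assms])
  then show ?thesis
    by (simp add: liouville_measure_def cong: measurable_cong_sets sets_restrict_space_cong)
qed

lemma liouville_integral_eq: "liouville_integral P f = (\<integral>q. f (pt P (fst q) (snd q)) \<partial>liouville_measure)"
  by (simp add: liouville_integral_def set_lebesgue_integral_def liouville_measure_def integral_restrict_space case_prod_beta)

lemma integrable_liouville_measure:
  fixes f :: "_ \<Rightarrow> 'b::{banach, second_countable_topology}"
  assumes "f \<in> borel_measurable liouville_measure" "\<And>q. q \<in> interior P \<times> torus_cell \<Longrightarrow> norm (f q) \<le> B"
  shows "integrable liouville_measure f"
  using assms by (intro finite_measure.integrable_const_bound[OF finite_liouville_measure, where B = B] AE_I2)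
     (auto simp: space_liouville_measure)

lemma integral_liouville_measure_product:
  fixes k :: "real^'n \<Rightarrow> real" and g :: "real^'n \<Rightarrow> 'b::{banach, second_countable_topology}"
  assumes "integrable liouville_measure (\<lambda>q. k (fst q) *\<^sub>R g (snd q))"
    and k: "integrable lborel (\<lambda>x. indicator (interior P) x * k x)"
  shows "(\<integral>q. k (fst q) *\<^sub>R g (snd q) \<partial>liouville_measure) =
    (\<integral>x. indicator (interior P) x * k x \<partial>lborel) *\<^sub>R (\<integral>\<theta>. indicator torus_cell \<theta> *\<^sub>R g \<theta> \<partial>lborel)"
proof -
  let ?f = "\<lambda>q. indicator (interior P \<times> torus_cell) q *\<^sub>R (k (fst q) *\<^sub>R g (snd q))"
  have int: "integrable (lborel \<Otimes>\<^sub>M lborel) ?f"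
    using assms by (simp add: liouville_measure_def integrable_restrict_space lborel_prod)
  have "(\<integral>q. k (fst q) *\<^sub>R g (snd q) \<partial>liouville_measure) = (\<integral>q. ?f q \<partial>(lborel \<Otimes>\<^sub>M lborel))"
    by (simp add: liouville_measure_def integral_restrict_space lborel_prod)
  also have "\<dots> = (\<integral>x. (\<integral>\<theta>. ?f (x, \<theta>) \<partial>lborel) \<partial>lborel)"
    by (rule lborel_pair.integral_fst'[OF int, symmetric])
  also have "\<dots> = (\<integral>x. (indicator (interior P) x * k x) *\<^sub>R (\<integral>\<theta>. indicator torus_cell \<theta> *\<^sub>R g \<theta> \<partial>lborel) \<partial>lborel)"
  proof (intro Bochner_Integration.integral_cong refl)
    fix x :: "real^'n"
    have "?f (x, \<theta>) = (indicator (interior P) x * k x) *\<^sub>R (indicator torus_cell \<theta> *\<^sub>R g \<theta>)" for \<theta>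
      by (simp add: indicator_def)
    then show "(\<integral>\<theta>. ?f (x, \<theta>) \<partial>lborel) = (indicator (interior P) x * k x) *\<^sub>R (\<integral>\<theta>. indicator torus_cell \<theta> *\<^sub>R g \<theta> \<partial>lborel)"
      by (simp only: integral_scaleR_right)
  qed
  also have "\<dots> = (\<integral>x. indicator (interior P) x * k x \<partial>lborel) *\<^sub>R (\<integral>\<theta>. indicator torus_cell \<theta> *\<^sub>R g \<theta> \<partial>lborel)"
    using k by (intro integral_scaleR_left)
  finally show ?thesis .
qed

lemma liouville_sublevel_pos:
  assumes "continuous_on (interior P) f" "\<exists>x\<in>interior P. f x < (c::real)"
  shows "0 < measure liouville_measure {q \<in> space liouville_measure. f (fst q) < c}"
proof -
  let ?A = "{q \<in> space liouville_measure. f (fst q) < c}"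
  obtain Q where Q: "open Q" "Q \<inter> interior P = {x \<in> interior P. f x < c}"
    using open_Collect_less_Int[OF assms(1) continuous_on_const[of _ c]] by blast
  obtain x where x: "x \<in> interior P" "f x < c" using assms(2) by blast
  let ?U = "(Q \<inter> interior P) \<times> box 0 (\<chi> i. 2 * pi) :: ((real^'n) \<times> (real^'n)) set"
  let ?y = "(\<chi> i. pi) :: real^'n"
  have U: "open ?U" by (intro open_Times open_Int Q open_interior open_box)
  have UA: "?U \<subseteq> ?A" using Q(2) box_subset_cbox by (auto simp: space_liouville_measure torus_cell_def)
  have "(x, ?y) \<in> ?U" using Q(2) x by (auto simp: mem_box_cart)
  then obtain e where e: "0 < e" "ball (x, ?y) e \<subseteq> ?U"
    using U open_contains_ball by metis
  have [measurable]: "(\<lambda>q. f (fst q)) \<in> borel_measurable liouville_measure"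
    by (intro continuous_imp_measurable continuous_on_compose2[OF assms(1)]) (auto intro: continuous_intros)
  have A: "?A \<in> sets liouville_measure" by measurable
  have sub: "ball (x, ?y) e \<subseteq> interior P \<times> torus_cell"
    using e(2) UA unfolding space_liouville_measure by blast
  have "0 < measure lborel (ball (x, ?y) e)" using e(1) by (rule content_ball_pos)
  also have "\<dots> = measure liouville_measure (ball (x, ?y) e)"
    unfolding liouville_measure_def using sub by (intro measure_restrict_space[symmetric]) auto
  also have "\<dots> \<le> measure liouville_measure ?A"
    by (rule finite_measure.finite_measure_mono[OF finite_liouville_measure _ A]) (use e(2) UA in blast)
  finally show ?thesis .
qed

section \<open>Test sections\<close>

lemma test_sections_iff: "\<tau> \<in> test_sections P \<longleftrightarrow>
    (\<forall>v p. \<not> (v \<in> vertices P \<and> p \<in> chart_dom P v) \<longrightarrow> \<tau> v p = 0) \<and>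
    (\<forall>v\<in>vertices P. \<forall>w\<in>vertices P. \<forall>p \<in> chart_dom P v \<inter> chart_dom P w.
        \<tau> w p = cis (- ((v - w) \<bullet> angles p)) * \<tau> v p) \<and>
    (\<forall>v\<in>vertices P. smooth_on (chart P v ` chart_dom P v) (\<lambda>z. \<tau> v (inv_into (chart_dom P v) (chart P v) z)))"
  by (simp add: test_sections_def smooth_sections_def in_chart_def comp_def)

lemma test_zero: "\<tau> \<in> test_sections P \<Longrightarrow> \<not> (v \<in> vertices P \<and> p \<in> chart_dom P v) \<Longrightarrow> \<tau> v p = 0"
  and test_transition: "\<tau> \<in> test_sections P \<Longrightarrow> v \<in> vertices P \<Longrightarrow> w \<in> vertices P \<Longrightarrow>
    p \<in> chart_dom P v \<Longrightarrow> p \<in> chart_dom P w \<Longrightarrow> \<tau> w p = cis (- ((v - w) \<bullet> angles p)) * \<tau> v p"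
  and test_smooth: "\<tau> \<in> test_sections P \<Longrightarrow> v \<in> vertices P \<Longrightarrow>
    smooth_on (chart P v ` chart_dom P v) (\<lambda>z. \<tau> v (inv_into (chart_dom P v) (chart P v) z))"
  unfolding test_sections_iff by blast+

lemma test_sections_add:
  assumes "\<tau> \<in> test_sections P" "\<tau>' \<in> test_sections P"
  shows "(\<lambda>v p. \<tau> v p + \<tau>' v p) \<in> test_sections P"
  unfolding test_sections_iff
proof (intro conjI allI ballI impI)
  fix v w p assume vw: "v \<in> vertices P" "w \<in> vertices P" "p \<in> chart_dom P v \<inter> chart_dom P w"
  then show "\<tau> w p + \<tau>' w p = cis (- ((v - w) \<bullet> angles p)) * (\<tau> v p + \<tau>' v p)"
    using test_transition[OF assms(1) vw(1,2)] test_transition[OF assms(2) vw(1,2)]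
    by (metis IntD1 IntD2 distrib_left)
qed (auto simp: test_zero[OF assms(1)] test_zero[OF assms(2)] intro!: smooth_on_add open_chart_image
    test_smooth[OF assms(1)] test_smooth[OF assms(2)])

lemma test_sections_scale:
  assumes "\<tau> \<in> test_sections P"
  shows "(\<lambda>v p. c * \<tau> v p) \<in> test_sections P"
  unfolding test_sections_iff
proof (intro conjI allI ballI impI)
  fix v w p assume vw: "v \<in> vertices P" "w \<in> vertices P" "p \<in> chart_dom P v \<inter> chart_dom P w"
  then show "c * \<tau> w p = cis (- ((v - w) \<bullet> angles p)) * (c * \<tau> v p)"
    using test_transition[OF assms vw(1,2)] by (metis IntD1 IntD2 mult.left_commute)
qed (auto simp: test_zero[OF assms] intro!: smooth_on_linear_image[OF bounded_linear_mult_right] open_chart_image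
    test_smooth[OF assms])

lemma continuous_on_in_chart:
  assumes "\<tau> \<in> test_sections P" "v \<in> vertices P"
  shows "continuous_on (chart P v ` chart_dom P v) (in_chart P v (\<tau> v))"
  using assms by (intro smooth_on_imp_continuous_on) (simp add: test_sections_def smooth_sections_def)

lemma continuous_on_test:
  assumes "\<tau> \<in> test_sections P" "v \<in> vertices P"
  shows "continuous_on (vertex_star P v \<times> UNIV) (\<lambda>q. \<tau> v (pt P (fst q) (snd q)))"
proof -
  have "continuous_on (vertex_star P v \<times> UNIV) (\<lambda>q. in_chart P v (\<tau> v) (polar v (fst q) (snd q)))"
    using continuous_on_polar[unfolded case_prod_beta]
    by (rule continuous_on_compose2[OF continuous_on_in_chart[OF assms]]) (auto intro: polar_in_image assms(2))
  then show ?thesis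
    by (rule continuous_on_eq) (auto simp: in_chart_polar assms(2))
qed

text \<open>For every \<open>x\<close> of \<open>P\<close> some product over the facets away from a vertex is nonzero; by
  compactness the sum over the vertices of these products is bounded below, so that finitely many
  compact subsets of the charts already cover the manifold.\<close>

lemma compact_cover:
  obtains K where "\<And>v. v \<in> vertices P \<Longrightarrow> compact (K v)"
    "\<And>v. v \<in> vertices P \<Longrightarrow> K v \<subseteq> chart P v ` chart_dom P v"
    "\<And>x \<theta>. x \<in> P \<Longrightarrow> \<theta> \<in> torus_cell \<Longrightarrow> \<exists>v\<in>vertices P. x \<in> vertex_star P v \<and> polar v x \<theta> \<in> K v"
proof -
  define f where "f = (\<lambda>v x. \<Prod>r\<in>facet_data P - active P v. ell r x)"
  have f0: "0 \<le> f v x" if "x \<in> P" for v x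
    using that ell_nonneg by (auto simp: f_def intro!: prod_nonneg)
  have fstar: "f v x \<noteq> 0 \<longleftrightarrow> x \<in> vertex_star P v" if "v \<in> vertices P" "x \<in> P" for v x
    using that finite_facets by (auto simp: f_def vertex_star_iff active_def)
  have contf: "continuous_on S (f v)" for v S
    unfolding f_def by (intro continuous_on_prod continuous_on_ell)
  have "P \<noteq> {}" using interior_nonempty by auto
  moreover have "continuous_on P (\<lambda>x. \<Sum>v\<in>vertices P. f v x)" by (intro continuous_on_sum contf)
  ultimately obtain a where a: "a \<in> P" "\<And>x. x \<in> P \<Longrightarrow> (\<Sum>v\<in>vertices P. f v a) \<le> (\<Sum>v\<in>vertices P. f v x)"
    using continuous_attains_inf[OF compact_P] by metis
  obtain w where w: "w \<in> vertices P" "a \<in> vertex_star P w" using exists_vertex[OF a(1)] .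
  define c where "c = (\<Sum>v\<in>vertices P. f v a) / card (vertices P)"
  have card: "0 < card (vertices P)" using w(1) finite_vertices card_gt_0_iff by blast
  have "0 < (\<Sum>v\<in>vertices P. f v a)"
    using w fstar[OF w(1) a(1)] f0[OF a(1)] by (intro sum_pos2[OF finite_vertices w(1)]) (auto simp: less_le)
  then have c: "0 < c" using card by (simp add: c_def)
  define C where "C = (\<lambda>v. {x \<in> P. c \<le> f v x})"
  have C: "compact (C v)" for v
  proof -
    have "closed {x. c \<le> f v x}" by (intro closed_Collect_le contf continuous_on_const)
    then show ?thesis
      using compact_Int_closed[OF compact_P] by (simp add: C_def Collect_conj_eq)
  qed
  have Cstar: "x \<in> vertex_star P v" if "v \<in> vertices P" "x \<in> C v" for v x
    using that c fstar[of v x] by (auto simp: C_def)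
  define K where "K = (\<lambda>v. (\<lambda>q. polar v (fst q) (snd q)) ` (C v \<times> torus_cell))"
  show thesis
  proof
    fix v assume v: "v \<in> vertices P"
    show "compact (K v)"
      unfolding K_def using continuous_on_polar[unfolded case_prod_beta]
      by (intro compact_continuous_image compact_Times C compact_torus_cell)
    show "K v \<subseteq> chart P v ` chart_dom P v"
      using polar_in_image[OF v] Cstar[OF v] by (auto simp: K_def)
  next
    fix x \<theta> :: "real^'n" assume x: "x \<in> P" and \<theta>: "\<theta> \<in> torus_cell"
    have "\<exists>v\<in>vertices P. c \<le> f v x"
    proof (rule ccontr)
      assume "\<not> ?thesis"
      then have "(\<Sum>v\<in>vertices P. f v x) < (\<Sum>v\<in>vertices P. c)"
        using finite_vertices w(1) by (intro sum_strict_mono) auto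
      then show False using a(2)[OF x] card by (simp add: c_def)
    qed
    then obtain v where v: "v \<in> vertices P" "x \<in> C v" using x by (auto simp: C_def)
    then show "\<exists>v\<in>vertices P. x \<in> vertex_star P v \<and> polar v x \<theta> \<in> K v"
      using Cstar[OF v] \<theta> by (intro bexI[of _ v]) (auto simp: K_def image_iff intro!: bexI[of _ "(x, \<theta>)"])
  qed
qed

text \<open>The transition functions are unitary, so the modulus of a test section does not depend on
  the chart and is controlled by its values on the compact pieces.\<close>

lemma test_bound:
  assumes \<tau>: "\<tau> \<in> test_sections P" and v: "v \<in> vertices P" and x: "x \<in> vertex_star P v"
    and w: "w \<in> vertices P" "x \<in> vertex_star P w" "cmod (in_chart P w (\<tau> w) (polar w x \<theta>)) \<le> B"
  shows "cmod (\<tau> v (pt P x \<theta>)) \<le> B"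
proof -
  have xP: "x \<in> P" using vertex_star_subset[OF v x] .
  have "\<tau> v (pt P x \<theta>) = cis (- ((w - v) \<bullet> angles (pt P x \<theta>))) * \<tau> w (pt P x \<theta>)"
    by (rule test_transition[OF \<tau> w(1) v]) (simp_all add: pt_chart_dom_iff[OF xP] v w x)
  then show ?thesis using w(3) by (simp add: norm_mult in_chart_polar[OF w(1,2)])
qed

lemma test_bounded:
  assumes \<tau>: "\<tau> \<in> test_sections P" and v: "v \<in> vertices P"
  obtains B where "\<And>x \<theta>. x \<in> vertex_star P v \<Longrightarrow> \<theta> \<in> torus_cell \<Longrightarrow> cmod (\<tau> v (pt P x \<theta>)) \<le> B"
proof -
  obtain K where K: "\<And>v. v \<in> vertices P \<Longrightarrow> compact (K v)"
    "\<And>v. v \<in> vertices P \<Longrightarrow> K v \<subseteq> chart P v ` chart_dom P v"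
    "\<And>x \<theta>. x \<in> P \<Longrightarrow> \<theta> \<in> torus_cell \<Longrightarrow> \<exists>v\<in>vertices P. x \<in> vertex_star P v \<and> polar v x \<theta> \<in> K v"
    using compact_cover by blast
  have "\<exists>B. \<forall>z\<in>K w. cmod (in_chart P w (\<tau> w) z) \<le> B" if w: "w \<in> vertices P" for w
  proof -
    have "compact (in_chart P w (\<tau> w) ` K w)"
      by (intro compact_continuous_image continuous_on_subset[OF continuous_on_in_chart[OF \<tau> w]] K w)
    then show ?thesis using compact_imp_bounded by (force simp: bounded_iff)
  qed
  then obtain B where B: "\<And>w z. w \<in> vertices P \<Longrightarrow> z \<in> K w \<Longrightarrow> cmod (in_chart P w (\<tau> w) z) \<le> B w" by metis
  show thesis
  proof
    fix x \<theta> :: "real^'n" assume x: "x \<in> vertex_star P v" and \<theta>: "\<theta> \<in> torus_cell"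
    obtain w where w: "w \<in> vertices P" "x \<in> vertex_star P w" "polar w x \<theta> \<in> K w"
      using K(3)[OF vertex_star_subset[OF v x] \<theta>] by blast
    have "B w \<le> Max (B ` vertices P)" using w(1) finite_vertices by (intro Max_ge) auto
    then show "cmod (\<tau> v (pt P x \<theta>)) \<le> Max (B ` vertices P)"
      using B[OF w(1,3)] by (intro test_bound[OF \<tau> v x w(1,2)]) linarith
  qed
qed

end

section \<open>The monomial weight\<close>

lemma smooth_on_ell: "open S \<Longrightarrow> smooth_on S (ell r)"
  unfolding ell_def[abs_def]
  by (intro smooth_on_diff smooth_on_linear bounded_linear_inner_right smooth_on_const)

lemma cis_sum: "finite I \<Longrightarrow> cis (\<Sum>i\<in>I. f i) = (\<Prod>i\<in>I. cis (f i))"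
  by (simp add: cis_conv_exp sum_distrib_left exp_sum)

text \<open>The function \<open>\<phi>\<close> is smooth up to the boundary through an extension \<open>\<Phi>\<close> to a neighbourhood
  \<open>V\<close> of \<open>P\<close>. Keeping \<open>\<Phi>\<close> as a parameter gives a function whose derivatives make sense on all of
  \<open>P\<close>.\<close>

locale toric_potential = delzant_polytope P
  for P :: "(real^'n) set" +
  fixes \<phi> \<Phi> \<psi> :: "real^'n \<Rightarrow> real" and V :: "(real^'n) set" and m :: "real^'n"
  assumes open_V: "open V" and P_subset_V: "P \<subseteq> V"
    and smooth_\<Phi>: "smooth_on V \<Phi>" and \<Phi>_eq: "\<And>x. x \<in> P \<Longrightarrow> \<Phi> x = \<phi> x"
    and smooth_\<psi>: "smooth_on V \<psi>" and pos_def_\<psi>: "\<And>x. x \<in> V \<Longrightarrow> pos_def (Hess \<psi> x)"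
    and pos_def_\<phi>: "\<And>x. x \<in> interior P \<Longrightarrow> pos_def (Hess (\<lambda>y. guillemin_potential P y + \<phi> y) x)"
    and m_mem: "m \<in> P" and m_lattice: "m \<in> lattice"
begin

abbreviation "pot s \<equiv> potential P \<phi> \<psi> s"

lemma interior_subset_V: "interior P \<subseteq> V"
  using interior_subset P_subset_V by blast

text \<open>The order of vanishing of the monomial section along the facet \<open>r\<close>. As a natural number it
  gives \<open>0 ^ 0 = 1\<close> on the facets through \<open>m\<close>, where a real exponent would give \<open>0\<close>.\<close>

definition mult_at :: "(int^'n) \<times> int \<Rightarrow> nat" where
  "mult_at r = nat \<lfloor>ell r m\<rfloor>"

lemma mult_at: "r \<in> facet_data P \<Longrightarrow> real (mult_at r) = ell r m"
proof -
  assume r: "r \<in> facet_data P"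
  obtain j where "m = real_vec j" using m_lattice by (auto simp: lattice_def)
  then have "ell r m = real_of_int ((\<Sum>i\<in>UNIV. fst r $ i * j $ i) - snd r)"
    by (simp add: ell_def inner_real_vec)
  then obtain i :: int where "ell r m = real_of_int i" by blast
  then show ?thesis
    using ell_nonneg[OF m_mem r] by (simp add: mult_at_def)
qed

lemma smooth_guillemin: "smooth_on (interior P) (guillemin_potential P)"
proof -
  have "smooth_on (interior P) (\<lambda>x. \<Sum>r\<in>facet_data P. ell r x * ln (ell r x))"
    by (intro smooth_on_sum finite_facets open_interior smooth_on_mult smooth_on_ell
        smooth_on_compose[OF _ _ smooth_on_ell smooth_on_ln]) (auto simp: ell_pos_interior)
  from smooth_on_linear_image[OF bounded_linear_mult_right[of "1/2"] open_interior this]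
  show ?thesis by (simp add: guillemin_potential_def[abs_def])
qed

lemma h_fun_guillemin:
  assumes x: "x \<in> interior P"
  shows "h_fun (guillemin_potential P) m x =
     (1/2) * (\<Sum>r\<in>facet_data P. ell r x - ell r m - ell r m * ln (ell r x))"
proof -
  let ?a = "(1/2) *\<^sub>R (\<Sum>r\<in>facet_data P. (ln (ell r x) + 1) *\<^sub>R real_vec (fst r))"
  have "((\<lambda>y. ell r y * ln (ell r y)) has_derivative
      (\<lambda>u. (ln (ell r x) + 1) * (real_vec (fst r) \<bullet> u))) (at x)" if r: "r \<in> facet_data P" for r
  proof -
    have l: "(ell r has_derivative (\<lambda>u. real_vec (fst r) \<bullet> u)) (at x)"
      unfolding ell_def[abs_def] by (auto intro!: derivative_eq_intros)
    have p: "0 < ell r x" using ell_pos_interior[OF x r] .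
    show ?thesis
      by (rule has_derivative_eq_rhs, (rule derivative_intros l p)+) (use p in \<open>auto simp: fun_eq_iff field_simps\<close>)
  qed
  then have "((\<lambda>y. (1/2) * (\<Sum>r\<in>facet_data P. ell r y * ln (ell r y))) has_derivative
      (\<lambda>u. (1/2) * (\<Sum>r\<in>facet_data P. (ln (ell r x) + 1) * (real_vec (fst r) \<bullet> u)))) (at x)"
    by (intro has_derivative_mult_right has_derivative_sum) auto
  then have "grad (guillemin_potential P) x = ?a"
    by (intro grad_eqI) (simp add: guillemin_potential_def[abs_def] inner_sum_left)
  then have "h_fun (guillemin_potential P) m x =
    (1/2) * (\<Sum>r\<in>facet_data P. (ln (ell r x) + 1) * (ell r x - ell r m) - ell r x * ln (ell r x))"
    by (simp add: h_fun_def guillemin_potential_def inner_sum_right ell_diff inner_commute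
        sum_subtractf right_diff_distrib)
  also have "\<dots> = (1/2) * (\<Sum>r\<in>facet_data P. ell r x - ell r m - ell r m * ln (ell r x))"
    by (intro arg_cong[where f = "\<lambda>t. (1/2) * t"] sum.cong refl) (simp add: algebra_simps)
  finally show ?thesis .
qed

lemma smooth_pot: "smooth_on (interior P) (pot s)"
proof (rule smooth_on_cong)
  show "smooth_on (interior P) (\<lambda>y. guillemin_potential P y + \<Phi> y + s * \<psi> y)"
    by (intro smooth_on_add open_interior smooth_guillemin smooth_on_linear_image[OF bounded_linear_mult_right]
        smooth_on_subset[OF smooth_\<Phi> interior_subset_V] smooth_on_subset[OF smooth_\<psi> interior_subset_V])
  show "guillemin_potential P y + \<Phi> y + s * \<psi> y = pot s y" if "y \<in> interior P" for y
    using that interior_subset \<Phi>_eq by (auto simp: potential_def)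
qed simp

lemma smooth_\<phi>: "smooth_on (interior P) \<phi>"
  by (rule smooth_on_cong[OF open_interior _ smooth_on_subset[OF smooth_\<Phi> interior_subset_V]])
     (use interior_subset \<Phi>_eq in auto)

lemma invertible_Hess_pot:
  assumes "x \<in> interior P" "0 < s"
  shows "invertible (Hess (pot s) x)"
proof -
  have "pot s = (\<lambda>y. (guillemin_potential P y + \<phi> y) + s * \<psi> y)"
    by (simp add: potential_def[abs_def])
  then have "Hess (pot s) x = Hess (\<lambda>y. guillemin_potential P y + \<phi> y) x + s *\<^sub>R Hess \<psi> x"
    using Hess_add_scale[OF open_interior smooth_on_add[OF open_interior smooth_guillemin smooth_\<phi>]
        smooth_on_subset[OF smooth_\<psi> interior_subset_V] assms(1)] by simp
  moreover have "x \<in> V" using assms(1) interior_subset_V by blast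
  ultimately show ?thesis
    using pos_def_invertible[OF pos_def_add_scale[OF pos_def_\<phi>[OF assms(1)] pos_def_\<psi> assms(2)]] by simp
qed

text \<open>The closed form of \<open>exp (- h)\<close>: the logarithmic singularities of the potential
  exponentiate to half-integral powers of the facet functions, which extend continuously to the
  boundary.\<close>

definition weight :: "real \<Rightarrow> real^'n \<Rightarrow> real" where
  "weight s x = (\<Prod>r\<in>facet_data P. sqrt (ell r x) ^ mult_at r) *
     exp (- (1/2) * (\<Sum>r\<in>facet_data P. ell r x - ell r m) - h_fun \<Phi> m x - s * h_fun \<psi> m x)"

lemma continuous_h_\<Phi>: "continuous_on P (h_fun \<Phi> m)" and continuous_h_\<psi>: "continuous_on P (h_fun \<psi> m)"
  using smooth_on_imp_continuous_on[OF smooth_on_h_fun[OF open_V smooth_\<Phi>]]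
    smooth_on_imp_continuous_on[OF smooth_on_h_fun[OF open_V smooth_\<psi>]] P_subset_V
  by (auto intro: continuous_on_subset)

lemma continuous_weight: "continuous_on P (weight s)"
  unfolding weight_def
  by (intro continuous_intros continuous_on_ell continuous_h_\<Phi> continuous_h_\<psi>)

lemma weight_pos: "x \<in> interior P \<Longrightarrow> 0 < weight s x"
  unfolding weight_def by (intro mult_pos_pos prod_pos) (simp_all add: ell_pos_interior)

lemma weight_split: "weight s x = weight 0 x * exp (- s * h_fun \<psi> m x)"
proof -
  have "exp (a - s * b) = exp (a - 0 * b) * exp (- s * b)" for a b :: real
    by (simp add: exp_add[symmetric])
  then show ?thesis by (simp only: weight_def mult.assoc)
qed

lemma exp_neg_h_interior:
  assumes x: "x \<in> interior P"
  shows "exp (- h_fun (pot s) m x) = weight s x"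
proof -
  have xV: "x \<in> V" using x interior_subset_V by blast
  have d: "guillemin_potential P differentiable (at x)" "\<Phi> differentiable (at x)" "\<psi> differentiable (at x)"
    using smooth_guillemin smooth_\<Phi> smooth_\<psi> x xV by (auto intro: smooth_on_imp_differentiable)
  have "h_fun (pot s) m x = h_fun (\<lambda>y. (guillemin_potential P y + 1 * \<Phi> y) + s * \<psi> y) m x"
    using interior_subset[of P] \<Phi>_eq
    by (intro h_fun_cong_open[OF open_interior x]) (simp add: potential_def subset_iff)
  also have "\<dots> = h_fun (guillemin_potential P) m x + h_fun \<Phi> m x + s * h_fun \<psi> m x"
    using h_fun_add_scale[OF differentiable_add[OF d(1,2)] d(3), of s m] h_fun_add_scale[OF d(1,2), of 1 m]
    by simp
  also have "\<dots> = (\<Sum>r\<in>facet_data P. - (real (mult_at r) * (ln (ell r x) / 2)))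
      + ((1/2) * (\<Sum>r\<in>facet_data P. ell r x - ell r m) + h_fun \<Phi> m x + s * h_fun \<psi> m x)"
    by (simp add: h_fun_guillemin[OF x] sum_subtractf sum_negf mult_at sum_divide_distrib diff_divide_distrib)
  finally have "exp (- h_fun (pot s) m x) = exp (\<Sum>r\<in>facet_data P. real (mult_at r) * (ln (ell r x) / 2)) *
      exp (- (1/2) * (\<Sum>r\<in>facet_data P. ell r x - ell r m) - h_fun \<Phi> m x - s * h_fun \<psi> m x)"
    by (simp add: exp_add[symmetric] sum_negf)
  moreover have "exp (real (mult_at r) * (ln (ell r x) / 2)) = sqrt (ell r x) ^ mult_at r"
    if "r \<in> facet_data P" for r
    using ell_pos_interior[OF x that] by (simp only: exp_of_nat_mult ln_sqrt[symmetric]) simp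
  ultimately show ?thesis
    by (simp add: weight_def exp_sum finite_facets)
qed

text \<open>Boundary points are limits of interior points, where both sides agree, and the closed form is
  continuous up to the boundary.\<close>

lemma exp_neg_h_eq_weight:
  assumes x: "x \<in> P"
  shows "exp_neg_h P (pot s) m x = weight s x"
proof (cases "x \<in> interior P")
  case True
  then show ?thesis by (simp add: exp_neg_h_def exp_neg_h_interior)
next
  case False
  then have "x islimpt interior P"
    using x closure_interior_P by (auto simp: closure_def)
  then have nontriv: "at x within interior P \<noteq> bot"
    by (simp add: trivial_limit_within)
  have "(weight s \<longlongrightarrow> weight s x) (at x within interior P)"
    using continuous_weight x interior_subset by (meson continuous_on_def tendsto_within_subset)
  then have "((\<lambda>x'. exp (- h_fun (pot s) m x')) \<longlongrightarrow> weight s x) (at x within interior P)"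
    by (rule tendsto_cong[THEN iffD1, rotated]) (simp add: eventually_at_filter exp_neg_h_interior)
  then show ?thesis
    using False tendsto_Lim[OF nontriv] by (simp add: exp_neg_h_def)
qed

section \<open>Monomial sections are smooth and holomorphic\<close>

lemma phase_eq: "v \<in> vertices P \<Longrightarrow> phase P m v p = cis ((m - v) \<bullet> angles p)"
  by (simp add: phase_def ell_at_inner_vartheta)

text \<open>The phase is single valued over \<open>x\<close> as soon as every facet through \<open>x\<close> contains \<open>m\<close>, for
  then \<open>m - v\<close> annihilates the normals that generate the ambiguity of the angles.\<close>

lemma phase_pt:
  assumes v: "v \<in> vertices P" and x: "x \<in> vertex_star P v" and xm: "active P x \<subseteq> active P m"
  shows "phase P m v (pt P x \<theta>) = cis ((m - v) \<bullet> \<theta>)"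
proof -
  have xP: "x \<in> P" using vertex_star_subset[OF v x] .
  obtain k where k: "angles (pt P x \<theta>) - \<theta> - (2 * pi) *\<^sub>R real_vec k \<in> span ((real_vec \<circ> fst) ` active P x)"
    using angles_pt[OF xP, of \<theta>] by (auto simp: angle_rel_def)
  have "span ((real_vec \<circ> fst) ` active P x) \<subseteq> {y. (m - v) \<bullet> y = 0}"
  proof (rule span_minimal)
    have "(m - v) \<bullet> real_vec (fst r) = 0" if "r \<in> active P x" for r
    proof -
      have "ell r m = 0" "ell r v = 0"
        using that xm x by (auto simp: vertex_star_iff[OF v] active_def)
      then show ?thesis using ell_diff[of r m v] by (simp add: inner_commute)
    qed
    then show "(real_vec \<circ> fst) ` active P x \<subseteq> {y. (m - v) \<bullet> y = 0}" by auto
    show "subspace {y. (m - v) \<bullet> y = 0}" by (rule subspace_hyperplane)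
  qed
  then have "(m - v) \<bullet> angles (pt P x \<theta>) = (m - v) \<bullet> \<theta> + 2 * pi * ((m - v) \<bullet> real_vec k)"
    using k by (auto simp: inner_diff_right)
  moreover obtain a b where "m = real_vec a" "v = real_vec b"
    using m_lattice vertex_lattice[OF v] by (auto simp: lattice_def)
  then have "(m - v) \<bullet> real_vec k = real_of_int ((\<Sum>i\<in>UNIV. a $ i * k $ i) - (\<Sum>i\<in>UNIV. b $ i * k $ i))"
    by (simp add: inner_diff_left inner_real_vec)
  ultimately show ?thesis
    by (simp only: phase_eq[OF v] cis_add_int)
qed

text \<open>The coefficient of the monomial section in the frame at \<open>v\<close>, before normalization and as a
  function of the coordinates \<open>z\<close> alone.\<close>

definition chart_coeff :: "real \<Rightarrow> real^'n \<Rightarrow> complex^'n \<Rightarrow> complex" where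
  "chart_coeff s v z = (\<Prod>j\<in>UNIV. (z $ j / complex_of_real (sqrt 2)) ^ mult_at (facet_order P v j)) *
     complex_of_real ((\<Prod>r\<in>facet_data P - active P v. sqrt (ell r (moment_of v z)) ^ mult_at r) *
       exp (- (1/2) * (\<Sum>r\<in>facet_data P. ell r (moment_of v z) - ell r m)
         - h_fun \<Phi> m (moment_of v z) - s * h_fun \<psi> m (moment_of v z)))"

text \<open>In the chart at \<open>v\<close> the square root \<open>sqrt l\<^sub>j\<close> of a facet function combines with the
  corresponding angular factor into the complex coordinate \<open>z\<^sub>j / sqrt 2\<close>, and the half-integral
  powers of the weight become honest monomials.\<close>

lemma monomial_section_chart:
  assumes v: "v \<in> vertices P" and p: "p \<in> chart_dom P v"
  shows "monomial_section P (pot s) m v p = chart_coeff s v (chart P v p)"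
proof -
  define x \<theta> where "x = moment p" and "\<theta> = vartheta P v (angles p)"
  define e where "e = facet_order P v"
  have x: "x \<in> P" using chart_dom_moment[OF p] vertex_star_subset[OF v] by (simp add: x_def)
  have act: "active P v \<subseteq> facet_data P" by (auto simp: active_def)
  have z: "chart P v p $ j / complex_of_real (sqrt 2) = complex_of_real (sqrt (ell (e j) x)) * cis (\<theta> $ j)" for j
    by (simp add: chart_def x_def \<theta>_def e_def ell_at_nth real_sqrt_mult)
  have mom: "moment_of v (chart P v p) = x"
    using x by (simp add: chart_eq_polar moment_of_polar[OF v] x_def)
  have "phase P m v p = (\<Prod>j\<in>UNIV. cis (\<theta> $ j) ^ mult_at (e j))"
  proof -
    have "ell_at P v m \<bullet> \<theta> = (\<Sum>j\<in>UNIV. real (mult_at (e j)) * \<theta> $ j)"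
      using subsetD[OF act facet_order_active[OF v]] mult_at by (simp add: inner_vec_def ell_at_nth e_def)
    then show ?thesis by (simp add: phase_def \<theta>_def[symmetric] cis_sum Complex.DeMoivre)
  qed
  moreover have "(\<Prod>r\<in>facet_data P. sqrt (ell r x) ^ mult_at r) =
      (\<Prod>r\<in>facet_data P - active P v. sqrt (ell r x) ^ mult_at r) * (\<Prod>j\<in>UNIV. sqrt (ell (e j) x) ^ mult_at (e j))"
    unfolding prod.subset_diff[OF act finite_facets] e_def
    by (simp only: prod.reindex_bij_betw[OF facet_order_bij[OF v], symmetric])
  moreover have "monomial_section P (pot s) m v p = complex_of_real (weight s x) * phase P m v p"
    using v p x by (simp add: monomial_section_def exp_neg_h_eq_weight x_def)
  ultimately show ?thesis
    unfolding chart_coeff_def mom z e_def[symmetric]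
    by (simp add: weight_def power_mult_distrib prod.distrib mult_ac)
qed

lemma smooth_chart_coeff:
  assumes v: "v \<in> vertices P"
  shows "smooth_on (chart P v ` chart_dom P v) (chart_coeff s v)"
proof -
  let ?S = "chart P v ` chart_dom P v"
  have S: "open ?S" by (rule open_chart_image[OF v])
  have mV: "moment_of v ` ?S \<subseteq> V" using moment_of_image[OF v] P_subset_V by blast
  note mo = smooth_on_moment_of[OF S, of v]
  have ell: "smooth_on ?S (\<lambda>z. ell r (moment_of v z))" for r
    by (rule smooth_on_compose[OF S _ mo smooth_on_ell[OF open_UNIV]]) simp
  have h: "smooth_on ?S (\<lambda>z. h_fun g m (moment_of v z))" if "smooth_on V g" for g
    by (rule smooth_on_compose[OF S mV mo smooth_on_h_fun[OF open_V that]])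
  have sq: "smooth_on ?S (\<lambda>z. sqrt (ell r (moment_of v z)))" if "r \<in> facet_data P - active P v" for r
    by (rule smooth_on_compose[OF S _ ell smooth_on_sqrt]) (use that chart_image_eq[OF v] in auto)
  have ex: "smooth_on ?S (\<lambda>z. exp (f z))" if "smooth_on ?S f" for f :: "complex^'n \<Rightarrow> real"
    by (rule smooth_on_compose[OF S _ that smooth_on_exp]) simp
  have lin: "smooth_on ?S (\<lambda>z. z $ j / c)" for j :: 'n and c :: complex
    by (intro smooth_on_linear_image[OF bounded_linear_divide] smooth_on_linear bounded_linear_vec_nth S)
  show ?thesis
    unfolding chart_coeff_def[abs_def]
    by (intro smooth_on_mult S smooth_on_prod smooth_on_power finite lin smooth_on_linear_image[OF bounded_linear_of_real]
        sq finite_Diff finite_facets ex smooth_on_diff smooth_on_linear_image[OF bounded_linear_mult_right] smooth_on_sum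
        ell smooth_on_const h smooth_\<Phi> smooth_\<psi>)
qed

lemma normalized_section_smooth: "normalized_section P (pot s) m \<in> smooth_sections P 1"
proof -
  let ?N = "complex_of_real (L1_norm P (monomial_section P (pot s) m))"
  let ?s = "normalized_section P (pot s) m"
  have "smooth_on (chart P v ` chart_dom P v) (in_chart P v (?s v))" if v: "v \<in> vertices P" for v
  proof (rule smooth_on_cong[OF open_chart_image[OF v]])
    show "smooth_on (chart P v ` chart_dom P v) (\<lambda>z. chart_coeff s v z / ?N)"
      by (intro smooth_on_linear_image[OF bounded_linear_divide] open_chart_image v smooth_chart_coeff)
    fix z assume z: "z \<in> chart P v ` chart_dom P v"
    show "chart_coeff s v z / ?N = in_chart P v (?s v) z"
      using monomial_section_chart[OF v inv_into_into[OF z], of s] f_inv_into_f[OF z]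
      by (simp add: in_chart_def normalized_section_def)
  qed
  moreover have "?s w p = cis ((v - w) \<bullet> angles p) * ?s v p"
    if "v \<in> vertices P" "w \<in> vertices P" "p \<in> chart_dom P v \<inter> chart_dom P w" for v w p
    using that by (simp add: normalized_section_def monomial_section_def phase_eq cis_mult
        inner_diff_left algebra_simps)
  ultimately show ?thesis
    by (auto simp: smooth_sections_def normalized_section_def monomial_section_def)
qed

lemma normalized_section_interior:
  assumes "v \<in> vertices P" "x \<in> interior P"
  shows "normalized_section P (pot s) m v (pt P x \<theta>) =
    exp (complex_of_real (- h_fun (pot s) m x) + \<i> * complex_of_real ((m - v) \<bullet> \<theta>)) /
      complex_of_real (L1_norm P (monomial_section P (pot s) m))"
proof -
  have x: "x \<in> vertex_star P v" "x \<in> P"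
    using assms interior_subset_vertex_star interior_subset by auto
  have ph: "phase P m v (pt P x \<theta>) = cis ((m - v) \<bullet> \<theta>)"
    using assms x by (intro phase_pt) (auto simp: active_interior)
  have "normalized_section P (pot s) m v (pt P x \<theta>) =
    complex_of_real (exp (- h_fun (pot s) m x)) * cis ((m - v) \<bullet> \<theta>) /
      complex_of_real (L1_norm P (monomial_section P (pot s) m))"
    using assms x by (simp add: normalized_section_def monomial_section_def pt_chart_dom_iff moment_pt exp_neg_h_def ph)
  then show ?thesis
    by (simp only: exp_add cis_conv_exp exp_of_real)
qed

text \<open>With \<open>H\<close> the Hessian of the potential, the covariant derivative of the section \<open>F\<close> along
  \<open>(a, b)\<close> is \<open>- F\<close> times \<open>(x - m) \<bullet> H a + \<i> (x - m) \<bullet> b\<close>. The complex structure sends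
  \<open>(a, b)\<close> to \<open>(- H\<inverse> b, H a)\<close>, which multiplies this expression by \<open>\<i>\<close>; the two terms of the
  Cauchy-Riemann equation cancel.\<close>

lemma normalized_section_holomorphic:
  assumes s: "0 < s"
  shows "normalized_section P (pot s) m \<in> holomorphic_sections P (pot s)"
proof -
  let ?s = "normalized_section P (pot s) m"
  have "nabla P v ?s (x, \<theta>) t + \<i> * nabla P v ?s (x, \<theta>) (cplx_str (pot s) x t) = 0"
    if v: "v \<in> vertices P" and x: "x \<in> interior P" for v x \<theta> t
  proof -
    let ?H = "Hess (pot s) x"
    let ?N = "complex_of_real (L1_norm P (monomial_section P (pot s) m))"
    let ?u = "\<lambda>q. complex_of_real (- h_fun (pot s) m (fst q)) + \<i> * complex_of_real ((m - v) \<bullet> snd q)"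
    define F where "F = ?s v (pt P x \<theta>)"
    define D where "D = (\<lambda>t. complex_of_real (- ((x - m) \<bullet> (?H *v fst t))) + \<i> * complex_of_real ((m - v) \<bullet> snd t))"
    \<comment> \<open>Near \<open>(x, \<theta>)\<close> the section is the exponential of a function whose derivative is \<open>D\<close>.\<close>
    have h: "((\<lambda>q. h_fun (pot s) m (fst q)) has_derivative (\<lambda>t. (x - m) \<bullet> (?H *v fst t))) (at (x, \<theta>))"
      using has_derivative_compose[OF has_derivative_fst[OF has_derivative_ident]]
        has_derivative_h_fun[OF open_interior smooth_pot x, of s m] by fastforce
    have u: "(?u has_derivative D) (at (x, \<theta>))"
      unfolding D_def by (intro derivative_intros h)
    have "((\<lambda>q. exp (?u q) / ?N) has_derivative (\<lambda>t. exp (?u (x, \<theta>)) * D t / ?N)) (at (x, \<theta>))"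
      using has_derivative_compose[OF u DERIV_exp[unfolded has_field_derivative_def]]
      by (intro bounded_linear.has_derivative[OF bounded_linear_divide])
    then have "((\<lambda>(x, \<theta>). ?s v (pt P x \<theta>)) has_derivative (\<lambda>t. exp (?u (x, \<theta>)) * D t / ?N)) (at (x, \<theta>))"
      by (rule has_derivative_transform_within_open[where s = "interior P \<times> UNIV"])
         (use x in \<open>auto simp: open_Times normalized_section_interior[OF v]\<close>)
    moreover have "exp (?u (x, \<theta>)) * D t / ?N = F * D t" for t
      by (simp add: F_def normalized_section_interior[OF v x])
    ultimately have "frechet_derivative (\<lambda>(x, \<theta>). ?s v (pt P x \<theta>)) (at (x, \<theta>)) = (\<lambda>t. F * D t)"
      by (metis (no_types, lifting) ext frechet_derivative_at)
    then have nab: "nabla P v ?s (x, \<theta>) t = F * (complex_of_real (- ((x - m) \<bullet> (?H *v fst t)))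
        - \<i> * complex_of_real ((x - m) \<bullet> snd t))" for t
      by (simp add: nabla_def D_def F_def[symmetric] inner_diff_left algebra_simps)
    have "?H *v (- (matrix_inv ?H *v snd t)) = - snd t"
      using matrix_inv_inverse(1)[OF invertible_Hess_pot[OF x s]]
      by (simp add: matrix_vector_mul_assoc linear_neg[OF matrix_vector_mul_linear])
    then show ?thesis
      by (simp add: nab cplx_str_def algebra_simps)
  qed
  then show ?thesis
    using normalized_section_smooth by (simp add: holomorphic_sections_def)
qed

section \<open>The delta section\<close>

text \<open>The phase of the monomial section times the test section, the angular part of the pairing.
  It is continuous on the whole star of \<open>v\<close>, so also at \<open>m\<close> once the star contains \<open>m\<close>.\<close>

definition integrand :: "real^'n \<Rightarrow> ('n section_family) \<Rightarrow> (real^'n) \<times> (real^'n) \<Rightarrow> complex" where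
  "integrand v \<tau> q = cis ((m - v) \<bullet> snd q) * \<tau> v (pt P (fst q) (snd q))"

lemma continuous_on_integrand:
  assumes "\<tau> \<in> test_sections P" "v \<in> vertices P"
  shows "continuous_on (vertex_star P v \<times> UNIV) (integrand v \<tau>)"
proof -
  have "continuous_on (vertex_star P v \<times> UNIV) (\<lambda>q. cis ((m - v) \<bullet> snd q))"
    by (rule continuous_on_compose2[of UNIV cis]) (auto intro!: continuous_intros)
  then show ?thesis
    unfolding integrand_def[abs_def] by (intro continuous_on_mult continuous_on_test assms)
qed

lemma norm_integrand: "cmod (integrand v \<tau> q) = cmod (\<tau> v (pt P (fst q) (snd q)))"
  by (simp add: integrand_def norm_mult)

lemma integrand_add: "integrand v (\<lambda>v p. \<tau> v p + \<tau>' v p) q = integrand v \<tau> q + integrand v \<tau>' q"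
  and integrand_scale: "integrand v (\<lambda>v p. c * \<tau> v p) q = c * integrand v \<tau> q"
  by (simp_all add: integrand_def algebra_simps)

definition delta_vertex :: "real^'n" where
  "delta_vertex = (SOME v. v \<in> vertices P \<and> orbit P m \<subseteq> chart_dom P v)"

lemma delta_vertex: "delta_vertex \<in> vertices P" "m \<in> vertex_star P delta_vertex"
proof -
  obtain v where "v \<in> vertices P" "m \<in> vertex_star P v" using exists_vertex[OF m_mem] .
  then have "\<exists>v. v \<in> vertices P \<and> orbit P m \<subseteq> chart_dom P v"
    by (auto simp: orbit_def chart_dom_def)
  then have *: "delta_vertex \<in> vertices P \<and> orbit P m \<subseteq> chart_dom P delta_vertex"
    unfolding delta_vertex_def by (rule someI_ex)
  then show "delta_vertex \<in> vertices P" by simp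
  have "pt P m 0 \<in> orbit P m" using m_mem by (auto simp: orbit_def moment_pt toric_mfd_iff)
  then show "m \<in> vertex_star P delta_vertex"
    using * m_mem by (auto simp: pt_chart_dom_iff)
qed

lemma continuous_integrand_m:
  assumes "\<tau> \<in> test_sections P"
  shows "continuous_on UNIV (\<lambda>\<theta>. integrand delta_vertex \<tau> (m, \<theta>))"
  by (rule continuous_on_compose2[OF continuous_on_integrand[OF assms delta_vertex(1)]])
     (auto intro!: continuous_intros simp: delta_vertex)

lemma delta_section_eq:
  assumes "\<tau> \<in> test_sections P"
  shows "delta_section P m \<tau> =
    (\<integral>\<theta>. indicator torus_cell \<theta> *\<^sub>R integrand delta_vertex \<tau> (m, \<theta>) \<partial>lborel) /\<^sub>R
      measure lborel (torus_cell :: (real^'n) set)"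
proof -
  have "(\<lambda>\<theta>. integrand delta_vertex \<tau> (m, \<theta>)) \<in> borel_measurable borel"
    by (rule borel_measurable_continuous_onI[OF continuous_integrand_m[OF assms]])
  then show ?thesis
    using assms by (simp add: delta_section_def Let_def delta_vertex_def[symmetric] orbit_integral_def
        phase_pt[OF delta_vertex order_refl] integrand_def integral_uniform_torus)
qed

lemma integrable_cell_integrand:
  assumes "\<tau> \<in> test_sections P"
  shows "integrable lborel (\<lambda>\<theta>. indicator torus_cell \<theta> *\<^sub>R integrand delta_vertex \<tau> (m, \<theta>))"
  by (intro borel_integrable_compact compact_torus_cell continuous_on_subset[OF continuous_integrand_m[OF assms]]) simp

text \<open>The functional averages over a single orbit, so the supremum over the compact image of that
  orbit in one chart bounds it.\<close>

lemma delta_section_distribution: "delta_section P m \<in> distributions P"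
proof -
  let ?v = delta_vertex
  let ?c = "measure lborel (torus_cell :: (real^'n) set)"
  define K where "K = polar ?v m ` torus_cell"
  have "continuous_on torus_cell (\<lambda>\<theta>. (\<lambda>(x, \<theta>). polar ?v x \<theta>) (m, \<theta>))"
    by (rule continuous_on_compose2[OF continuous_on_polar[where S = UNIV]]) (auto intro!: continuous_intros)
  then have K: "compact K"
    unfolding K_def by (intro compact_continuous_image compact_torus_cell) simp
  have Kimg: "K \<subseteq> chart P ?v ` chart_dom P ?v"
    unfolding K_def using polar_in_image[OF delta_vertex] by blast
  have bound: "cmod (delta_section P m \<tau>) \<le> 1 * B"
    if \<tau>: "\<tau> \<in> test_sections P" and B: "0 \<le> B" "\<forall>z\<in>K. cmod (in_chart P ?v (\<tau> ?v) z) \<le> B" for \<tau> B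
  proof -
    have "cmod (integrand ?v \<tau> (m, \<theta>)) \<le> B" if "\<theta> \<in> torus_cell" for \<theta>
      using B(2) that by (simp add: norm_integrand in_chart_polar[OF delta_vertex, symmetric] K_def)
    then have "cmod (indicator torus_cell \<theta> *\<^sub>R integrand ?v \<tau> (m, \<theta>)) \<le> B * indicator torus_cell \<theta>" for \<theta>
      by (simp add: indicator_def)
    moreover have "integrable lborel (\<lambda>\<theta>. B * indicator (torus_cell :: (real^'n) set) \<theta>)"
      by (intro integrable_mult_right) (simp add: integrable_indicator_iff emeasure_torus_cell)
    ultimately have "cmod (\<integral>\<theta>. indicator torus_cell \<theta> *\<^sub>R integrand ?v \<tau> (m, \<theta>) \<partial>lborel)
        \<le> (\<integral>\<theta>. B * indicator (torus_cell :: (real^'n) set) \<theta> \<partial>lborel)"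
      using integrable_cell_integrand[OF \<tau>]
      by (intro order_trans[OF integral_norm_bound] integral_mono integrable_norm) auto
    also have "\<dots> = B * ?c" by simp
    finally show ?thesis
      using torus_cell_measure[where 'n = 'n] by (simp add: delta_section_eq[OF \<tau>] field_simps)
  qed
  have add: "delta_section P m (\<lambda>v p. \<tau> v p + \<tau>' v p) = delta_section P m \<tau> + delta_section P m \<tau>'"
    if "\<tau> \<in> test_sections P" "\<tau>' \<in> test_sections P" for \<tau> \<tau>'
    using that by (simp add: delta_section_eq test_sections_add integrand_add scaleR_add_right
        integrable_cell_integrand Bochner_Integration.integral_add)
  have scale: "delta_section P m (\<lambda>v p. c * \<tau> v p) = c * delta_section P m \<tau>"
    if "\<tau> \<in> test_sections P" for \<tau> c
    using that by (simp add: delta_section_eq test_sections_scale integrand_scale mult_scaleR_right[symmetric] del: mult_scaleR_right)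
  have "\<exists>C Q. finite Q \<and> (\<forall>(v, K, hs)\<in>Q. v \<in> vertices P \<and> compact K \<and> K \<subseteq> chart P v ` chart_dom P v) \<and>
        (\<forall>\<tau>\<in>test_sections P. \<forall>B\<ge>0.
           (\<forall>(v, K, hs)\<in>Q. \<forall>z\<in>K. cmod (iter_deriv hs (in_chart P v (\<tau> v)) z) \<le> B) \<longrightarrow>
           cmod (delta_section P m \<tau>) \<le> C * B)"
    by (rule exI[of _ 1], rule exI[of _ "{(?v, K, [])}"]) (use bound K Kimg delta_vertex in auto)
  then show ?thesis
    using add scale by (simp add: distributions_def delta_section_def)
qed

section \<open>Normalized sections as distributions\<close>

lemma mass_eq: "L1_norm P (monomial_section P (pot s) m) = (\<integral>q. weight s (fst q) \<partial>liouville_measure)"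
proof -
  have "cmod (monomial_section P (pot s) m (vertex_at P (pt P x \<theta>)) (pt P x \<theta>)) = weight s x"
    if x: "x \<in> interior P" for x \<theta>
  proof -
    have xP: "x \<in> P" using x interior_subset by blast
    obtain v where "v \<in> vertices P" "x \<in> vertex_star P v" using exists_vertex[OF xP] .
    then have "\<exists>v. v \<in> vertices P \<and> pt P x \<theta> \<in> chart_dom P v" using xP by (auto simp: pt_chart_dom_iff)
    from someI_ex[OF this] have "vertex_at P (pt P x \<theta>) \<in> vertices P" "pt P x \<theta> \<in> chart_dom P (vertex_at P (pt P x \<theta>))"
      by (auto simp: vertex_at_def)
    then show ?thesis
      using weight_pos[OF x, of s]
      by (simp add: monomial_section_def norm_mult phase_def exp_neg_h_eq_weight moment_pt xP)
  qed
  then show ?thesis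
    unfolding L1_norm_def liouville_integral_eq
    by (intro Bochner_Integration.integral_cong refl) (auto simp: space_liouville_measure)
qed

lemma measurable_weight [measurable]: "(\<lambda>q. weight s (fst q)) \<in> borel_measurable liouville_measure"
  by (intro continuous_imp_measurable continuous_on_compose2[OF continuous_weight])
     (use interior_subset in \<open>auto intro!: continuous_intros\<close>)

lemma weight_bound: obtains C where "0 \<le> C" "\<And>x. x \<in> P \<Longrightarrow> \<bar>weight s x\<bar> \<le> C"
proof -
  have "bounded (weight s ` P)"
    by (intro compact_imp_bounded compact_continuous_image continuous_weight compact_P)
  then obtain C where "\<And>x. x \<in> P \<Longrightarrow> \<bar>weight s x\<bar> \<le> C" by (force simp: bounded_iff)
  then show thesis using that m_mem by (metis abs_ge_zero order_trans)
qed

lemma integrable_weight: "integrable liouville_measure (\<lambda>q. weight s (fst q))"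
proof -
  obtain C where "\<And>x. x \<in> P \<Longrightarrow> \<bar>weight s x\<bar> \<le> C" using weight_bound[of s] by blast
  then show ?thesis
    by (intro integrable_liouville_measure[where B = C]) (use interior_subset[of P] in auto)
qed

lemma measurable_integrand:
  assumes "\<tau> \<in> test_sections P" "v \<in> vertices P"
  shows "integrand v \<tau> \<in> borel_measurable liouville_measure"
  by (intro continuous_imp_measurable continuous_on_subset[OF continuous_on_integrand[OF assms]])
     (auto intro: interior_subset_vertex_star assms)

lemma integrable_weight_bounded:
  fixes f :: "_ \<Rightarrow> complex"
  assumes [measurable]: "f \<in> borel_measurable liouville_measure" and f: "\<And>q. q \<in> interior P \<times> torus_cell \<Longrightarrow> cmod (f q) \<le> B"
  shows "integrable liouville_measure (\<lambda>q. weight s (fst q) *\<^sub>R f q)"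
proof -
  obtain C where C: "0 \<le> C" "\<And>x. x \<in> P \<Longrightarrow> \<bar>weight s x\<bar> \<le> C" using weight_bound[of s] by blast
  show ?thesis
  proof (rule integrable_liouville_measure[where B = "C * B"])
    fix q :: "(real^'n) \<times> (real^'n)" assume q: "q \<in> interior P \<times> torus_cell"
    then have "\<bar>weight s (fst q)\<bar> * cmod (f q) \<le> C * B"
      using C f[OF q] q interior_subset[of P] by (intro mult_mono) auto
    then show "norm (weight s (fst q) *\<^sub>R f q) \<le> C * B" by simp
  qed measurable
qed

lemma integrable_integrand:
  assumes "\<tau> \<in> test_sections P" "v \<in> vertices P"
  shows "integrable liouville_measure (\<lambda>q. weight s (fst q) *\<^sub>R integrand v \<tau> q)"
proof -
  obtain B where "\<And>x \<theta>. x \<in> vertex_star P v \<Longrightarrow> \<theta> \<in> torus_cell \<Longrightarrow> cmod (\<tau> v (pt P x \<theta>)) \<le> B"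
    using test_bounded[OF assms] by blast
  then show ?thesis
    by (intro integrable_weight_bounded[where B = B] measurable_integrand assms)
       (auto simp: norm_integrand interior_subset_vertex_star assms)
qed

abbreviation "mass s \<equiv> (\<integral>q. weight s (fst q) \<partial>liouville_measure)"

lemma mass_pos: "0 < mass s"
proof -
  obtain x where x: "x \<in> interior P" using interior_nonempty by blast
  then have "0 < measure liouville_measure {q \<in> space liouville_measure. 0 < (1::real)}"
    using liouville_sublevel_pos[of "\<lambda>x. 0" 1] by auto
  then have "emeasure liouville_measure (space liouville_measure) \<noteq> 0"
    by (auto simp: measure_def)
  moreover have nn: "AE q in liouville_measure. 0 \<le> weight s (fst q)"
    by (rule AE_I2) (auto simp: space_liouville_measure weight_pos less_imp_le)
  moreover have "mass s \<noteq> 0"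
  proof
    assume "mass s = 0"
    then have "AE q in liouville_measure. weight s (fst q) = 0"
      using integral_nonneg_eq_0_iff_AE[OF integrable_weight nn] by simp
    then have "AE q in liouville_measure. False"
      by (rule AE_mp) (use weight_pos[of _ s] in \<open>force intro!: AE_I2 simp: space_liouville_measure\<close>)
    then show False
      using \<open>emeasure liouville_measure (space liouville_measure) \<noteq> 0\<close> by (subst (asm) AE_iff_measurable[OF sets.top]) auto
  qed
  ultimately show ?thesis
    using integral_nonneg_AE[OF nn] by simp
qed

text \<open>The phases of the frames cancel in the pairing, which can therefore be computed in any one
  chart.\<close>

lemma iota_eq:
  assumes \<tau>: "\<tau> \<in> test_sections P" and v: "v \<in> vertices P"
  shows "iota P (normalized_section P (pot s) m) \<tau> =
    (\<integral>q. weight s (fst q) *\<^sub>R integrand v \<tau> q \<partial>liouville_measure) /\<^sub>R mass s"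
proof -
  have "normalized_section P (pot s) m (vertex_at P p) p * \<tau> (vertex_at P p) p =
      (weight s x *\<^sub>R integrand v \<tau> (x, \<theta>)) /\<^sub>R mass s"
    if x: "x \<in> interior P" and p: "p = pt P x \<theta>" for x \<theta> p
  proof -
    have xP: "x \<in> P" using x interior_subset by blast
    have pv: "p \<in> chart_dom P v" unfolding p using xP x by (simp add: pt_chart_dom_iff v interior_subset_vertex_star)
    have "\<exists>v. v \<in> vertices P \<and> p \<in> chart_dom P v" using pv v by blast
    from someI_ex[OF this] have w: "vertex_at P p \<in> vertices P" "p \<in> chart_dom P (vertex_at P p)"
      by (auto simp: vertex_at_def)
    let ?w = "vertex_at P p"
    have "phase P m ?w p * \<tau> ?w p = phase P m v p * \<tau> v p"
      unfolding test_transition[OF \<tau> v w(1) pv w(2)] phase_eq[OF w(1)] phase_eq[OF v] mult.assoc[symmetric] cis_mult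
      by (simp add: inner_diff_left)
    also have "\<dots> = integrand v \<tau> (x, \<theta>)"
      unfolding p using phase_pt[OF v interior_subset_vertex_star[OF v x]] x
      by (simp add: integrand_def active_interior)
    finally have "phase P m ?w p * \<tau> ?w p = integrand v \<tau> (x, \<theta>)" .
    moreover have "normalized_section P (pot s) m ?w p = complex_of_real (weight s x) * phase P m ?w p / complex_of_real (mass s)"
      using w xP by (simp add: normalized_section_def monomial_section_def mass_eq exp_neg_h_eq_weight p moment_pt)
    ultimately show ?thesis
      by (simp add: scaleR_conv_of_real field_simps)
  qed
  then have "(\<integral>q. normalized_section P (pot s) m (vertex_at P (pt P (fst q) (snd q))) (pt P (fst q) (snd q)) *
        \<tau> (vertex_at P (pt P (fst q) (snd q))) (pt P (fst q) (snd q)) \<partial>liouville_measure) =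
    (\<integral>q. (weight s (fst q) *\<^sub>R integrand v \<tau> q) /\<^sub>R mass s \<partial>liouville_measure)"
    by (intro Bochner_Integration.integral_cong refl) (auto simp: space_liouville_measure)
  then show ?thesis
    using \<tau> by (simp only: iota_def restrict_apply' liouville_integral_eq integral_scaleR_right)
qed

text \<open>The weights have total mass one after normalization, so the pairing is bounded by the supremum
  of the test section, which finitely many compact pieces of the charts control.\<close>

lemma iota_distribution: "iota P (normalized_section P (pot s) m) \<in> distributions P"
proof -
  let ?u = "iota P (normalized_section P (pot s) m)"
  obtain v where v: "v \<in> vertices P" using exists_vertex[OF m_mem] by blast
  obtain K where K: "\<And>v. v \<in> vertices P \<Longrightarrow> compact (K v)"
    "\<And>v. v \<in> vertices P \<Longrightarrow> K v \<subseteq> chart P v ` chart_dom P v"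
    "\<And>x \<theta>. x \<in> P \<Longrightarrow> \<theta> \<in> torus_cell \<Longrightarrow> \<exists>v\<in>vertices P. x \<in> vertex_star P v \<and> polar v x \<theta> \<in> K v"
    using compact_cover by blast
  have bound: "cmod (?u \<tau>) \<le> 1 * B"
    if \<tau>: "\<tau> \<in> test_sections P" and B: "0 \<le> B" "\<And>w z. w \<in> vertices P \<Longrightarrow> z \<in> K w \<Longrightarrow> cmod (in_chart P w (\<tau> w) z) \<le> B" for \<tau> B
  proof -
    have le: "cmod (integrand v \<tau> q) \<le> B" if q: "q \<in> interior P \<times> torus_cell" for q
    proof -
      obtain x \<theta> where q: "q = (x, \<theta>)" "x \<in> interior P" "\<theta> \<in> torus_cell" using q by auto
      then obtain w where w: "w \<in> vertices P" "x \<in> vertex_star P w" "polar w x \<theta> \<in> K w"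
        using K(3)[of x \<theta>] interior_subset by blast
      have "cmod (\<tau> v (pt P x \<theta>)) \<le> B"
        using test_bound[OF \<tau> v interior_subset_vertex_star[OF v q(2)] w(1,2) B(2)[OF w(1,3)]] .
      then show ?thesis by (simp add: norm_integrand q)
    qed
    have "cmod (\<integral>q. weight s (fst q) *\<^sub>R integrand v \<tau> q \<partial>liouville_measure)
        \<le> (\<integral>q. cmod (weight s (fst q) *\<^sub>R integrand v \<tau> q) \<partial>liouville_measure)"
      by (rule integral_norm_bound)
    also have "\<dots> \<le> (\<integral>q. weight s (fst q) * B \<partial>liouville_measure)"
    proof (rule integral_mono)
      show "integrable liouville_measure (\<lambda>q. cmod (weight s (fst q) *\<^sub>R integrand v \<tau> q))"
        by (intro integrable_norm integrable_integrand \<tau> v)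
      show "integrable liouville_measure (\<lambda>q. weight s (fst q) * B)"
        by (intro integrable_mult_left integrable_weight)
      fix q assume q: "q \<in> space liouville_measure"
      then have "0 < weight s (fst q)" by (auto simp: space_liouville_measure weight_pos)
      then show "cmod (weight s (fst q) *\<^sub>R integrand v \<tau> q) \<le> weight s (fst q) * B"
        using le[of q] q by (simp add: space_liouville_measure)
    qed
    also have "\<dots> = mass s * B" by simp
    finally show ?thesis
      using mass_pos[of s] by (simp add: iota_eq[OF \<tau> v] field_simps)
  qed
  have add: "?u (\<lambda>v p. \<tau> v p + \<tau>' v p) = ?u \<tau> + ?u \<tau>'"
    if "\<tau> \<in> test_sections P" "\<tau>' \<in> test_sections P" for \<tau> \<tau>'
    using that by (simp add: iota_eq[OF _ v] test_sections_add integrand_add scaleR_add_right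
        integrable_integrand v Bochner_Integration.integral_add)
  have scale: "?u (\<lambda>v p. c * \<tau> v p) = c * ?u \<tau>"
    if "\<tau> \<in> test_sections P" for \<tau> c
    using that by (simp add: iota_eq[OF _ v] test_sections_scale integrand_scale mult_scaleR_right[symmetric] del: mult_scaleR_right)
  have "\<exists>C Q. finite Q \<and> (\<forall>(v, K, hs)\<in>Q. v \<in> vertices P \<and> compact K \<and> K \<subseteq> chart P v ` chart_dom P v) \<and>
        (\<forall>\<tau>\<in>test_sections P. \<forall>B\<ge>0.
           (\<forall>(v, K, hs)\<in>Q. \<forall>z\<in>K. cmod (iter_deriv hs (in_chart P v (\<tau> v)) z) \<le> B) \<longrightarrow>
           cmod (?u \<tau>) \<le> C * B)"
    by (rule exI[of _ 1], rule exI[of _ "(\<lambda>v. (v, K v, [])) ` vertices P"])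
       (use bound K(1,2) finite_vertices in auto)
  then show ?thesis
    using add scale by (simp add: distributions_def iota_def)
qed

section \<open>Convergence to the delta section\<close>

text \<open>The pairing is the mean of the integrand for the weights \<open>weight 0 x * exp (- s * h_fun \<psi> m x)\<close>.
  Replacing the integrand by its value over \<open>m\<close> turns this mean, by Fubini, into the value of the
  delta section; the error is small near \<open>m\<close>, and \<open>m\<close> is the strict minimum of \<open>h_fun \<psi> m\<close>.\<close>

lemma iota_tendsto_delta:
  assumes \<tau>: "\<tau> \<in> test_sections P"
  shows "((\<lambda>s. iota P (normalized_section P (pot s) m) \<tau>) \<longlongrightarrow> delta_section P m \<tau>) at_top"
proof -
  let ?v = delta_vertex
  define f where "f = h_fun \<psi> m"
  define D where "D = (\<lambda>q. integrand ?v \<tau> q - integrand ?v \<tau> (m, snd q))"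
  obtain B where B: "\<And>x \<theta>. x \<in> vertex_star P ?v \<Longrightarrow> \<theta> \<in> torus_cell \<Longrightarrow> cmod (\<tau> ?v (pt P x \<theta>)) \<le> B"
    using test_bounded[OF \<tau> delta_vertex(1)] by blast
  have Bm: "cmod (integrand ?v \<tau> (m, \<theta>)) \<le> B" if "\<theta> \<in> torus_cell" for \<theta>
    using B delta_vertex(2) that by (simp add: norm_integrand)
  have Bq: "cmod (integrand ?v \<tau> q) \<le> B" if "q \<in> interior P \<times> torus_cell" for q
    using B that interior_subset_vertex_star[OF delta_vertex(1)] by (auto simp: norm_integrand)
  have meas_m: "(\<lambda>q. integrand ?v \<tau> (m, snd q)) \<in> borel_measurable liouville_measure"
    by (intro continuous_imp_measurable continuous_on_compose2[OF continuous_integrand_m[OF \<tau>]])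
       (auto intro!: continuous_intros)
  have contf: "continuous_on P f" unfolding f_def by (rule continuous_h_\<psi>)
  have fmin: "f m < f x" if "x \<in> P" "x \<noteq> m" for x
    unfolding f_def by (rule h_fun_strict_min[OF open_V P_subset_V smooth_\<psi> pos_def_\<psi> convex_P m_mem that])
  obtain C where C: "\<And>x. x \<in> P \<Longrightarrow> \<bar>weight 0 x\<bar> \<le> C" using weight_bound by metis
  have lim: "((\<lambda>s. (\<integral>q. (weight 0 (fst q) * exp (- s * f (fst q))) *\<^sub>R D q \<partial>liouville_measure) /\<^sub>R
      (\<integral>q. weight 0 (fst q) * exp (- s * f (fst q)) \<partial>liouville_measure)) \<longlongrightarrow> 0) at_top"
  proof (rule laplace_concentration[OF finite_liouville_measure, where c = "f m" and C = C and B = "B + B"])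
    show "(\<lambda>q. weight 0 (fst q)) \<in> borel_measurable liouville_measure" by measurable
    show "(\<lambda>q. f (fst q)) \<in> borel_measurable liouville_measure"
      by (intro continuous_imp_measurable continuous_on_compose2[OF contf])
        (use interior_subset in \<open>auto intro!: continuous_intros\<close>)
    show "D \<in> borel_measurable liouville_measure"
      unfolding D_def by (intro borel_measurable_diff measurable_integrand \<tau> delta_vertex meas_m)
  next
    fix q assume "q \<in> space liouville_measure"
    then have q: "q \<in> interior P \<times> torus_cell" by (simp add: space_liouville_measure)
    then have qP: "fst q \<in> P" using interior_subset[of P] by auto
    show "0 < weight 0 (fst q)" using q by (auto simp: weight_pos)
    show "weight 0 (fst q) \<le> C" using C[OF qP] by simp
    show "f m \<le> f (fst q)" using fmin[OF qP] by (cases "fst q = m") auto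
    show "cmod (D q) \<le> B + B"
      unfolding D_def using Bq[OF q] Bm[of "snd q"] q
      by (intro order_trans[OF norm_triangle_ineq4] add_mono) auto
  next
    fix e :: real assume e: "0 < e"
    have "continuous_on (vertex_star P ?v \<times> torus_cell) (integrand ?v \<tau>)"
      by (rule continuous_on_subset[OF continuous_on_integrand[OF \<tau> delta_vertex(1)]]) auto
    then obtain X where X: "m \<in> X" "open X"
      "\<And>x t. x \<in> X \<inter> vertex_star P ?v \<Longrightarrow> t \<in> torus_cell \<Longrightarrow> dist (integrand ?v \<tau> (x, t)) (integrand ?v \<tau> (m, t)) \<le> e"
      using continuous_on_prod_compactE[OF _ compact_torus_cell delta_vertex(2) e] by metis
    \<comment> \<open>Small sublevel sets of \<open>f\<close> lie in any given neighbourhood of its strict minimum.\<close>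
    have "\<exists>\<eta>>0. \<forall>x\<in>P. f x < f m + \<eta> \<longrightarrow> x \<in> X"
    proof (cases "P - X = {}")
      case True
      then show ?thesis by (intro exI[of _ 1]) auto
    next
      case False
      have "compact (P - X)" using compact_P X(2) by (rule compact_diff)
      then obtain y where y: "y \<in> P - X" "\<And>x. x \<in> P - X \<Longrightarrow> f y \<le> f x"
        using continuous_attains_inf[OF _ False continuous_on_subset[OF contf]] by blast
      then have "f m < f y" using fmin[of y] X(1) by auto
      then show ?thesis using y(2) by (intro exI[of _ "f y - f m"]) force
    qed
    then obtain \<eta> where \<eta>: "0 < \<eta>" "\<And>x. x \<in> P \<Longrightarrow> f x < f m + \<eta> \<Longrightarrow> x \<in> X" by blast
    show "\<exists>\<eta>>0. \<forall>q\<in>space liouville_measure. f (fst q) < f m + \<eta> \<longrightarrow> cmod (D q) \<le> e"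
    proof (intro exI conjI ballI impI)
      fix q assume "q \<in> space liouville_measure" and fq: "f (fst q) < f m + \<eta>"
      then have q: "fst q \<in> interior P" "snd q \<in> torus_cell" by (auto simp: space_liouville_measure)
      then have "fst q \<in> X \<inter> vertex_star P ?v"
        using \<eta>(2)[OF _ fq] interior_subset interior_subset_vertex_star[OF delta_vertex(1)] by blast
      from X(3)[OF this q(2)] show "cmod (D q) \<le> e" by (simp add: D_def dist_norm)
    qed (rule \<eta>(1))
  next
    fix \<eta> :: real assume \<eta>: "0 < \<eta>"
    \<comment> \<open>The point \<open>m\<close> may lie on the boundary, but interior points come arbitrarily close to it.\<close>
    obtain d where d: "0 < d" "\<And>x. x \<in> P \<Longrightarrow> dist x m < d \<Longrightarrow> dist (f x) (f m) < \<eta>"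
      using contf m_mem \<eta> unfolding continuous_on_iff by metis
    have "m \<in> closure (interior P)" using m_mem closure_interior_P by simp
    then obtain x where x: "x \<in> interior P" "dist x m < d" using d(1) closure_approachable by metis
    then have "dist (f x) (f m) < \<eta>" using d(2) interior_subset by blast
    then have "f x < f m + \<eta>" by (simp add: dist_real_def)
    then show "0 < measure liouville_measure {q \<in> space liouville_measure. f (fst q) < f m + \<eta>}"
      using x(1) by (intro liouville_sublevel_pos continuous_on_subset[OF contf] interior_subset) auto
  qed
  have w: "weight 0 x * exp (- s * f x) = weight s x" for x s
    unfolding f_def by (rule weight_split[symmetric])
  have diff: "(\<integral>q. weight s (fst q) *\<^sub>R D q \<partial>liouville_measure) /\<^sub>R mass s =
      iota P (normalized_section P (pot s) m) \<tau> - delta_section P m \<tau>" for s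
  proof -
    let ?c = "measure lborel (torus_cell :: (real^'n) set)"
    let ?I = "\<integral>x. indicator (interior P) x * weight s x \<partial>lborel"
    let ?J = "\<integral>\<theta>. indicator torus_cell \<theta> *\<^sub>R integrand ?v \<tau> (m, \<theta>) \<partial>lborel"
    have intm: "integrable liouville_measure (\<lambda>q. weight s (fst q) *\<^sub>R integrand ?v \<tau> (m, snd q))"
      using Bm by (intro integrable_weight_bounded[where B = B] meas_m) auto
    have "set_integrable lborel P (weight s)"
      using borel_integrable_compact[OF compact_P continuous_weight] by (simp add: set_integrable_def)
    then have "set_integrable lborel (interior P) (weight s)"
      by (rule set_integrable_subset) (auto intro: interior_subset[THEN subsetD])
    then have intw: "integrable lborel (\<lambda>x. indicator (interior P) x * weight s x)"
      by (simp add: set_integrable_def)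
    have "mass s = ?I * (\<integral>\<theta>. indicator (torus_cell :: (real^'n) set) \<theta> *\<^sub>R (1::real) \<partial>lborel)"
      using integral_liouville_measure_product[of "weight s" "\<lambda>_. 1 :: real"] integrable_weight intw by simp
    then have mass: "mass s = ?I * ?c" by simp
    have "(\<integral>q. weight s (fst q) *\<^sub>R integrand ?v \<tau> (m, snd q) \<partial>liouville_measure) = ?I *\<^sub>R ?J"
      by (rule integral_liouville_measure_product[OF intm intw])
    also have "?I *\<^sub>R ?J = mass s *\<^sub>R delta_section P m \<tau>"
      using torus_cell_measure[where 'n = 'n] by (simp add: mass delta_section_eq[OF \<tau>])
    finally have "(\<integral>q. weight s (fst q) *\<^sub>R D q \<partial>liouville_measure) =
       (\<integral>q. weight s (fst q) *\<^sub>R integrand ?v \<tau> q \<partial>liouville_measure) - mass s *\<^sub>R delta_section P m \<tau>"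
      unfolding D_def scaleR_diff_right
      by (subst Bochner_Integration.integral_diff[OF integrable_integrand[OF \<tau> delta_vertex(1)] intm]) simp
    then show ?thesis
      using mass_pos[of s] by (simp add: iota_eq[OF \<tau> delta_vertex(1)] scaleR_diff_right)
  qed
  have "((\<lambda>s. iota P (normalized_section P (pot s) m) \<tau> - delta_section P m \<tau>) \<longlongrightarrow> 0) at_top"
    using lim unfolding w diff .
  then show ?thesis by (simp add: LIM_zero_iff)
qed

lemma iota_limitin_delta:
  "limitin (distribution_topology P) (\<lambda>s. iota P (normalized_section P (pot s) m)) (delta_section P m) at_top"
  unfolding distribution_topology_def limitin_subtopology limitin_componentwise
  using delta_section_distribution iota_distribution iota_tendsto_delta
  by (auto simp: delta_section_def iota_def PiE_def)

end

theorem theorem1p3: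
  fixes P :: "(real^'n) set" and \<phi> \<psi> :: "real^'n \<Rightarrow> real" and m :: "real^'n"
  assumes "delzant P"
    and "\<phi> \<in> C_inf_gP P"
    and "strictly_convex_near P \<psi>"
    and "m \<in> P \<inter> lattice"
  shows "(\<forall>s>0. normalized_section P (potential P \<phi> \<psi> s) m
                  \<in> holomorphic_sections P (potential P \<phi> \<psi> s)) \<and>
         limitin (distribution_topology P)
           (\<lambda>s::real. iota P (normalized_section P (potential P \<phi> \<psi> s) m))
           (delta_section P m) at_top"
proof -
  obtain U \<Phi> where U: "open U" "P \<subseteq> U" "smooth_on U \<Phi>" "\<And>x. x \<in> P \<Longrightarrow> \<Phi> x = \<phi> x"
    using assms(2) by (auto simp: C_inf_gP_def smooth_on_closed_def)
  obtain U' where U': "open U'" "P \<subseteq> U'" "smooth_on U' \<psi>" "\<And>x. x \<in> U' \<Longrightarrow> pos_def (Hess \<psi> x)"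
    using assms(3) by (auto simp: strictly_convex_near_def)
  interpret toric_potential P \<phi> \<Phi> \<psi> "U \<inter> U'" m
  proof
    show "smooth_on (U \<inter> U') \<Phi>" "smooth_on (U \<inter> U') \<psi>"
      using U(3) U'(3) by (auto intro: smooth_on_subset)
  qed (use assms U U' in \<open>auto simp: C_inf_gP_def\<close>)
  show ?thesis
    using normalized_section_holomorphic iota_limitin_delta by blast
qed

end
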